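(* Let $n\ge 3$, let $q$ be a prime power, and let $G=\operatorname{PSL}(n,q)$ (over the field with $q$ elements). Then $\Delta(G)\le 12(n-1)$ and consequently, if $S\subseteq G$ is a non-trivial conjugacy class, then $$\log|S|>\frac{\log|G|}{\Delta(G)}-2\ \ge\ (n+1)\cdot\frac{\log q}{12}-\frac{\log q+2}{12(n-1)}-2 .$$
   Context: $\log$ denotes $\log_2$. A non-trivial conjugacy class is the conjugacy class of a non-identity element. A subset $S$ of a group $G$ normally generates $G$ if the normal subgroup of $G$ generated by $S$ is $G$. For such $S$, $\|g\|_S$ is the least $m\ge 0$ such that $g$ is a product of $m$ conjugates in $G$ of elements of $S$ and their inverses, and $\|G\|_S=\sup_{g\in G}\|g\|_S$. $\Delta(G)=\sup\{\|G\|_S : S \text{ finite, normally generates } G\}$. *)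

theory Defs
  imports
    "HOL-Library.Cardinality"
    "HOL-Library.Extended_Real"
    "HOL-Number_Theory.Prime_Powers"
    "HOL-Algebra.Coset"
    "Jordan_Normal_Form.Determinant"
begin

definition normal_closure :: "('a, 'b) monoid_scheme \<Rightarrow> 'a set \<Rightarrow> 'a set" where
  "normal_closure G S = \<Inter>{N. N \<lhd> G \<and> S \<subseteq> N}"

definition normally_generates :: "('a, 'b) monoid_scheme \<Rightarrow> 'a set \<Rightarrow> bool" where
  "normally_generates G S \<longleftrightarrow> S \<subseteq> carrier G \<and> normal_closure G S = carrier G"

definition conjugacy_class :: "('a, 'b) monoid_scheme \<Rightarrow> 'a \<Rightarrow> 'a set" where
  "conjugacy_class G x = {g \<otimes>\<^bsub>G\<^esub> x \<otimes>\<^bsub>G\<^esub> inv\<^bsub>G\<^esub> g | g. g \<in> carrier G}"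

definition nontrivial_conjugacy_class :: "('a, 'b) monoid_scheme \<Rightarrow> 'a set \<Rightarrow> bool" where
  "nontrivial_conjugacy_class G C \<longleftrightarrow>
     (\<exists>x \<in> carrier G. x \<noteq> \<one>\<^bsub>G\<^esub> \<and> C = conjugacy_class G x)"

definition is_conj_product :: "('a, 'b) monoid_scheme \<Rightarrow> 'a set \<Rightarrow> nat \<Rightarrow> 'a \<Rightarrow> bool" where
  "is_conj_product G S m g \<longleftrightarrow>
     (\<exists>hs. length hs = m
         \<and> set hs \<subseteq> (\<Union>s\<in>S. conjugacy_class G s \<union> conjugacy_class G (inv\<^bsub>G\<^esub> s))
         \<and> g = foldr (\<otimes>\<^bsub>G\<^esub>) hs \<one>\<^bsub>G\<^esub>)"

(* Values are in enat because the suprema below may be infinite. The infimum over an empty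
   set of lengths is infinity; this does not happen when S normally generates G. *)
definition conj_norm :: "('a, 'b) monoid_scheme \<Rightarrow> 'a set \<Rightarrow> 'a \<Rightarrow> enat" where
  "conj_norm G S g = (INF m \<in> {m. is_conj_product G S m g}. enat m)"

definition conj_diameter :: "('a, 'b) monoid_scheme \<Rightarrow> 'a set \<Rightarrow> enat" where
  "conj_diameter G S = (SUP g \<in> carrier G. conj_norm G S g)"

definition Delta :: "('a, 'b) monoid_scheme \<Rightarrow> enat" where
  "Delta G = (SUP S \<in> {S. finite S \<and> normally_generates G S}. conj_diameter G S)"

definition group_center :: "('a, 'b) monoid_scheme \<Rightarrow> 'a set" where
  "group_center G = {z \<in> carrier G. \<forall>g \<in> carrier G. z \<otimes>\<^bsub>G\<^esub> g = g \<otimes>\<^bsub>G\<^esub> z}"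

definition SL :: "'a::field itself \<Rightarrow> nat \<Rightarrow> 'a mat monoid" where
  "SL _ n = \<lparr>carrier = {A \<in> carrier_mat n n. det A = 1}, mult = (*), one = 1\<^sub>m n\<rparr>"

definition PSL :: "'a::field itself \<Rightarrow> nat \<Rightarrow> 'a mat set monoid" where
  "PSL F n = SL F n Mod group_center (SL F n)"

end

theory Submission
  imports Defs
begin

text \<open>
  Write a transvection as \<open>I + u f\<^sup>T\<close> with \<open>f \<bullet> u = 0\<close>; we allow \<open>u = 0\<close> and \<open>f = 0\<close>.
  If \<open>A \<in> SL(n,q)\<close> is not central, some \<open>v\<close> is not an eigenvector of \<open>A\<close>. For a
  transvection \<open>E\<close> along \<open>v\<close> the commutator \<open>B = [A,E]\<close> is a nontrivial product of two
  transvections, so for \<open>n \<ge> 3\<close> it fixes a vector \<open>x \<noteq> 0\<close>. Either \<open>B\<close> is itself a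
  transvection along \<open>x\<close>, or \<open>[B,F]\<close> is a nontrivial one for a suitable transvection \<open>F\<close>
  along \<open>x\<close>. Hence a product of at most four conjugates of \<open>A\<close> and its inverse is a nontrivial
  transvection. For \<open>n \<ge> 3\<close> all nontrivial transvections are conjugate in \<open>SL(n,q)\<close>, and
  column elimination writes every element as a product of at most \<open>2n - 1\<close> transvections.
  This gives \<open>4(2n - 1) \<le> 12(n - 1)\<close>.

  For \<open>S\<close> the class of \<open>x\<close> and \<open>D = \<Delta>(G)\<close>, counting products of at most \<open>D\<close> elements of
  \<open>S\<close> and their inverses gives \<open>|G| \<le> \<Sum>\<^sub>m (2|S|)\<^sup>m < (4|S|)\<^sup>D\<close>, with \<open>m\<close> from
  0 to \<open>D\<close>. The explicit bound follows from \<open>2|G| \<ge> q^(n\<^sup>2 - 2)\<close>.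
\<close>

section \<open>Products of conjugates\<close>

text \<open>The ball of radius \<open>m\<close> for the conjugation norm. Allowing all lengths up to
  \<open>m\<close> makes it increasing in \<open>m\<close>; products of exactly \<open>m\<close>
  factors are not, since the identity need not be available as a filler.\<close>

definition conj_ball :: "('a, 'b) monoid_scheme \<Rightarrow> 'a set \<Rightarrow> nat \<Rightarrow> 'a set" where
  "conj_ball G S m = {g. \<exists>k\<le>m. is_conj_product G S k g}"

lemma conj_ball_mono: "m \<le> k \<Longrightarrow> conj_ball G S m \<subseteq> conj_ball G S k"
  unfolding conj_ball_def using order_trans by blast

lemma conj_ball_mono_set: "S \<subseteq> S' \<Longrightarrow> conj_ball G S m \<subseteq> conj_ball G S' m"
  unfolding conj_ball_def is_conj_product_def by (smt (verit) Collect_mono_iff UN_mono order_refl subset_trans)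

text \<open>A nonempty set of lengths attains its infimum, and an empty one has infimum infinity,
  which lies below no \<open>enat m\<close>. Bounds on the \<open>enat\<close> suprema thereby
  become membership statements about balls.\<close>

lemma conj_norm_le_iff: "conj_norm G S g \<le> enat m \<longleftrightarrow> g \<in> conj_ball G S m"
proof
  assume le: "conj_norm G S g \<le> enat m"
  let ?A = "enat ` {k. is_conj_product G S k g}"
  have "?A \<noteq> {}"
  proof
    assume "?A = {}"
    thus False using le unfolding conj_norm_def by (simp add: top_enat_def)
  qed
  hence "Inf ?A \<in> ?A"
    by (metis (full_types) Inf_enat_def LeastI ex_in_conv)
  thus "g \<in> conj_ball G S m"
    using le by (auto simp: conj_norm_def conj_ball_def)
next
  assume "g \<in> conj_ball G S m"
  thus "conj_norm G S g \<le> enat m"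
    unfolding conj_norm_def conj_ball_def by (auto intro: INF_lower2)
qed

context group
begin

lemma conjugacy_class_closed: "x \<in> carrier G \<Longrightarrow> conjugacy_class G x \<subseteq> carrier G"
  by (auto simp: conjugacy_class_def)

lemma conjugacy_class_conj:
  assumes "x \<in> carrier G" "y \<in> conjugacy_class G x" "g \<in> carrier G"
  shows "g \<otimes> y \<otimes> inv g \<in> conjugacy_class G x"
proof -
  obtain h where h: "h \<in> carrier G" "y = h \<otimes> x \<otimes> inv h"
    using assms by (auto simp: conjugacy_class_def)
  have "g \<otimes> y \<otimes> inv g = (g \<otimes> h) \<otimes> x \<otimes> inv (g \<otimes> h)"
    using assms h by (simp add: m_assoc inv_mult_group)
  thus ?thesis
    using assms h by (auto simp: conjugacy_class_def)
qed

lemma inv_conjugate: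
  assumes "x \<in> carrier G" "g \<in> carrier G"
  shows "inv (g \<otimes> x \<otimes> inv g) = g \<otimes> inv x \<otimes> inv g"
  using assms by (simp add: inv_mult_group m_assoc)

lemma conjugacy_class_inv:
  assumes "x \<in> carrier G"
  shows "conjugacy_class G (inv x) = (\<lambda>y. inv y) ` conjugacy_class G x"
  using assms by (force simp: conjugacy_class_def inv_conjugate)

lemma conj_generators_closed:
  assumes "S \<subseteq> carrier G" "y \<in> (\<Union>s\<in>S. conjugacy_class G s \<union> conjugacy_class G (inv s))"
  shows "y \<in> carrier G"
proof -
  obtain s where s: "s \<in> S" "y \<in> conjugacy_class G s \<union> conjugacy_class G (inv s)"
    using assms by blast
  thus ?thesis
    using assms conjugacy_class_closed[of s] conjugacy_class_closed[of "inv s"] by auto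
qed

lemma is_conj_product_0: "is_conj_product G S 0 g \<longleftrightarrow> g = \<one>"
  by (auto simp: is_conj_product_def)

text \<open>Splitting off the first factor turns the list definition into a recursion, on which the
  inductions on length rest.\<close>

lemma is_conj_product_Suc:
  "is_conj_product G S (Suc m) g \<longleftrightarrow>
    (\<exists>y z. y \<in> (\<Union>s\<in>S. conjugacy_class G s \<union> conjugacy_class G (inv s)) \<and>
       is_conj_product G S m z \<and> g = y \<otimes> z)"
  (is "?L \<longleftrightarrow> ?R")
proof
  assume ?L
  then obtain y hs where "length hs = m"
    "set (y # hs) \<subseteq> (\<Union>s\<in>S. conjugacy_class G s \<union> conjugacy_class G (inv s))"
    "g = foldr (\<otimes>) (y # hs) \<one>"
    unfolding is_conj_product_def length_Suc_conv by blast
  thus ?R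
    unfolding is_conj_product_def by (intro exI[of _ y] exI[of _ "foldr (\<otimes>) hs \<one>"]) auto
next
  assume ?R
  then obtain y hs where "length hs = m"
    "set (y # hs) \<subseteq> (\<Union>s\<in>S. conjugacy_class G s \<union> conjugacy_class G (inv s))"
    "g = foldr (\<otimes>) (y # hs) \<one>"
    unfolding is_conj_product_def by auto
  thus ?L
    unfolding is_conj_product_def by (intro exI[of _ "y # hs"]) auto
qed

lemma is_conj_product_closed:
  assumes S: "S \<subseteq> carrier G" and g: "is_conj_product G S m g"
  shows "g \<in> carrier G"
  using g
proof (induction m arbitrary: g)
  case 0
  thus ?case by (simp add: is_conj_product_0)
next
  case (Suc m)
  then obtain y z where *: "y \<in> (\<Union>s\<in>S. conjugacy_class G s \<union> conjugacy_class G (inv s))"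
    "is_conj_product G S m z" "g = y \<otimes> z"
    by (auto simp only: is_conj_product_Suc)
  have "y \<in> carrier G"
    by (rule conj_generators_closed[OF S *(1)])
  thus ?case using * Suc.IH by auto
qed

lemma is_conj_product_mult:
  assumes S: "S \<subseteq> carrier G" and "is_conj_product G S m g" "is_conj_product G S k h"
  shows "is_conj_product G S (m + k) (g \<otimes> h)"
  using assms(2)
proof (induction m arbitrary: g)
  case 0
  thus ?case using assms is_conj_product_closed by (simp add: is_conj_product_0)
next
  case (Suc m)
  then obtain y z where *: "y \<in> (\<Union>s\<in>S. conjugacy_class G s \<union> conjugacy_class G (inv s))"
    "is_conj_product G S m z" "g = y \<otimes> z"
    by (auto simp only: is_conj_product_Suc)
  have y: "y \<in> carrier G"
    by (rule conj_generators_closed[OF S *(1)])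
  have "g \<otimes> h = y \<otimes> (z \<otimes> h)"
    using * y is_conj_product_closed[OF S] assms(3) by (auto simp: m_assoc)
  thus ?case using *(1) Suc.IH[OF *(2)] by (auto simp: is_conj_product_Suc)
qed

lemma is_conj_product_1:
  assumes "S \<subseteq> carrier G" "y \<in> (\<Union>s\<in>S. conjugacy_class G s \<union> conjugacy_class G (inv s))"
  shows "is_conj_product G S 1 y"
proof -
  have "y \<in> carrier G"
    by (rule conj_generators_closed[OF assms])
  thus ?thesis
    using assms is_conj_product_Suc[of S 0 y] is_conj_product_0[of S \<one>] r_one by (metis One_nat_def)
qed

lemma is_conj_product_conj:
  assumes S: "S \<subseteq> carrier G" and g: "is_conj_product G S m g" and a: "a \<in> carrier G"
  shows "is_conj_product G S m (a \<otimes> g \<otimes> inv a)"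
  using g
proof (induction m arbitrary: g)
  case 0
  thus ?case using a by (simp add: is_conj_product_0)
next
  case (Suc m)
  then obtain y z where *: "y \<in> (\<Union>s\<in>S. conjugacy_class G s \<union> conjugacy_class G (inv s))"
    "is_conj_product G S m z" "g = y \<otimes> z"
    by (auto simp only: is_conj_product_Suc)
  have y: "y \<in> carrier G"
    by (rule conj_generators_closed[OF S *(1)])
  have z: "z \<in> carrier G" using * is_conj_product_closed[OF S] by blast
  have "a \<otimes> g \<otimes> inv a = (a \<otimes> y \<otimes> inv a) \<otimes> (a \<otimes> z \<otimes> inv a)"
    using * y z a by (simp add: m_assoc) (simp add: m_assoc[symmetric])
  moreover have "a \<otimes> y \<otimes> inv a \<in> (\<Union>s\<in>S. conjugacy_class G s \<union> conjugacy_class G (inv s))"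
  proof -
    obtain s where s: "s \<in> S" "y \<in> conjugacy_class G s \<union> conjugacy_class G (inv s)"
      using *(1) by blast
    hence "a \<otimes> y \<otimes> inv a \<in> conjugacy_class G s \<union> conjugacy_class G (inv s)"
      using conjugacy_class_conj[of s y a] conjugacy_class_conj[of "inv s" y a] a S by auto
    thus ?thesis using s by blast
  qed
  ultimately show ?case using Suc.IH[OF *(2)] by (auto simp: is_conj_product_Suc)
qed

text \<open>Inversion reverses the order, so the inverted first factor lands at the end; the
  induction appends it by \<open>is_conj_product_mult\<close> instead of prepending it.\<close>

lemma is_conj_product_inv:
  assumes S: "S \<subseteq> carrier G" and g: "is_conj_product G S m g"
  shows "is_conj_product G S m (inv g)"
  using g
proof (induction m arbitrary: g)
  case 0
  thus ?case by (simp add: is_conj_product_0)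
next
  case (Suc m)
  then obtain y z where *: "y \<in> (\<Union>s\<in>S. conjugacy_class G s \<union> conjugacy_class G (inv s))"
    "is_conj_product G S m z" "g = y \<otimes> z"
    by (auto simp only: is_conj_product_Suc)
  have y: "y \<in> carrier G"
    by (rule conj_generators_closed[OF S *(1)])
  have z: "z \<in> carrier G" using * is_conj_product_closed[OF S] by blast
  obtain s where s: "s \<in> S" "y \<in> conjugacy_class G s \<union> conjugacy_class G (inv s)"
    using *(1) by blast
  have "inv y \<in> conjugacy_class G s \<union> conjugacy_class G (inv s)"
    using s S conjugacy_class_inv[of s] conjugacy_class_inv[of "inv s"] subsetD[OF S s(1)] by auto
  hence "is_conj_product G S 1 (inv y)" using s S by (intro is_conj_product_1) auto
  thus ?case
    using is_conj_product_mult[OF S Suc.IH[OF *(2)]] * y z by (fastforce simp: inv_mult_group)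
qed

lemma conj_ball_one: "\<one> \<in> conj_ball G S m"
  by (auto simp: conj_ball_def is_conj_product_0 intro!: exI[of _ 0])

lemma conj_ball_generator: "S \<subseteq> carrier G \<Longrightarrow> s \<in> S \<Longrightarrow> s \<in> conj_ball G S 1"
proof -
  assume a: "S \<subseteq> carrier G" "s \<in> S"
  hence "s = \<one> \<otimes> s \<otimes> inv \<one>" by auto
  hence "s \<in> conjugacy_class G s" unfolding conjugacy_class_def by blast
  hence "is_conj_product G S 1 s" using a by (intro is_conj_product_1) auto
  thus ?thesis by (auto simp: conj_ball_def)
qed

lemma conj_ball_mult:
  assumes "S \<subseteq> carrier G" "g \<in> conj_ball G S m" "h \<in> conj_ball G S k"
  shows "g \<otimes> h \<in> conj_ball G S (m + k)"
  using assms is_conj_product_mult unfolding conj_ball_def mem_Collect_eq by (meson add_mono)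

lemma conj_ball_conj:
  "S \<subseteq> carrier G \<Longrightarrow> g \<in> conj_ball G S m \<Longrightarrow> a \<in> carrier G \<Longrightarrow> a \<otimes> g \<otimes> inv a \<in> conj_ball G S m"
  using is_conj_product_conj by (auto simp: conj_ball_def)

lemma conj_ball_inv: "S \<subseteq> carrier G \<Longrightarrow> g \<in> conj_ball G S m \<Longrightarrow> inv g \<in> conj_ball G S m"
  using is_conj_product_inv by (auto simp: conj_ball_def)

lemma conj_ball_closed: "S \<subseteq> carrier G \<Longrightarrow> conj_ball G S m \<subseteq> carrier G"
  using is_conj_product_closed by (auto simp: conj_ball_def)

text \<open>The commutator is \<open>g\<close> times a conjugate of \<open>inv g\<close>, so its
  cost depends on \<open>g\<close> alone and \<open>h\<close> may be chosen freely.\<close>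

lemma conj_ball_commutator:
  assumes "S \<subseteq> carrier G" "g \<in> conj_ball G S m" "h \<in> carrier G"
  shows "g \<otimes> (h \<otimes> inv g \<otimes> inv h) \<in> conj_ball G S (2 * m)"
  using conj_ball_mult[OF assms(1,2) conj_ball_conj[OF assms(1) conj_ball_inv[OF assms(1,2)] assms(3)]]
  by (simp add: mult_2)

section \<open>Normal generation and bounds on \<open>Delta\<close>\<close>

lemma one_normal: "{\<one>} \<lhd> G"
  by (simp add: normal_inv_iff triv_subgroup)

lemma normal_closure_one:
  assumes "S \<subseteq> {\<one>}" shows "normal_closure G S = {\<one>}"
proof -
  have "\<one> \<in> N" if "N \<lhd> G" for N
    using that normal_imp_subgroup subgroup.one_closed by blast
  thus ?thesis
    unfolding normal_closure_def using one_normal assms by blast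
qed

text \<open>A normal subgroup containing \<open>S\<close> absorbs inverses, conjugates and products,
  hence the whole ball. This makes one-element sets eligible in the supremum that defines
  \<open>Delta\<close>.\<close>

lemma normally_generates_of_conj_ball:
  assumes "S \<subseteq> carrier G" "\<And>g. g \<in> carrier G \<Longrightarrow> g \<in> conj_ball G S m"
  shows "normally_generates G S"
proof -
  have "g \<in> N" if N: "N \<lhd> G" "S \<subseteq> N" and "is_conj_product G S k g" for N k g
    using that(3)
  proof (induction k arbitrary: g)
    case 0
    thus ?case
      using subgroup.one_closed[OF normal_imp_subgroup[OF N(1)]] by (simp add: is_conj_product_0)
  next
    case (Suc k)
    then obtain y z where *: "y \<in> (\<Union>s\<in>S. conjugacy_class G s \<union> conjugacy_class G (inv s))"
      "is_conj_product G S k z" "g = y \<otimes> z"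
      by (auto simp only: is_conj_product_Suc)
    have sub: "subgroup N G" using N normal_imp_subgroup by blast
    have "y \<in> N"
      using *(1) N(2) normal.inv_op_closed2[OF N(1)] subgroup.m_inv_closed[OF sub]
      by (fastforce simp: conjugacy_class_def)
    thus ?case using * Suc.IH subgroup.m_closed[OF sub] by blast
  qed
  hence "carrier G \<subseteq> normal_closure G S"
    using assms(2) unfolding normal_closure_def conj_ball_def by blast
  moreover have "normal_closure G S \<subseteq> carrier G"
    unfolding normal_closure_def using assms(1) by (intro Inter_lower) (simp add: normal_inv_iff subgroup_self)
  ultimately show ?thesis using assms by (auto simp: normally_generates_def)
qed

text \<open>A generating set with a nontrivial element \<open>x\<close> has balls containing those
  of \<open>{x}\<close>. Without such an element the normal closure, and with it the group, is
  trivial.\<close>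

lemma Delta_le:
  assumes "\<And>x g. x \<in> carrier G \<Longrightarrow> x \<noteq> \<one> \<Longrightarrow> g \<in> carrier G \<Longrightarrow> g \<in> conj_ball G {x} m"
  shows "Delta G \<le> enat m"
  unfolding Delta_def conj_diameter_def
proof (intro SUP_least)
  fix S g
  assume "S \<in> {S. finite S \<and> normally_generates G S}" and g: "g \<in> carrier G"
  hence S: "S \<subseteq> carrier G" "normal_closure G S = carrier G" by (auto simp: normally_generates_def)
  have "g \<in> conj_ball G S m"
  proof (cases "S \<subseteq> {\<one>}")
    case True
    hence "g = \<one>" using S g normal_closure_one by auto
    thus ?thesis by (simp add: conj_ball_one)
  next
    case False
    then obtain x where "x \<in> S" "x \<noteq> \<one>" by blast
    thus ?thesis using assms[of x g] S g conj_ball_mono_set[of "{x}" S] by blast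
  qed
  thus "conj_norm G S g \<le> enat m" by (simp add: conj_norm_le_iff)
qed

section \<open>Counting products of conjugates\<close>

lemma card_conj_products_le:
  assumes fin: "finite (carrier G)" and x: "x \<in> carrier G"
  shows "card {g. is_conj_product G {x} m g} \<le> (2 * card (conjugacy_class G x)) ^ m"
proof -
  let ?C = "conjugacy_class G x \<union> conjugacy_class G (inv x)"
  have finC: "finite (conjugacy_class G x)"
    using fin x conjugacy_class_closed finite_subset by blast
  \<comment> \<open>The class of \<open>inv x\<close> is the image of the class of \<open>x\<close>
    under inversion, hence no larger.\<close>
  have "card (conjugacy_class G (inv x)) \<le> card (conjugacy_class G x)"
    using x finC by (simp add: conjugacy_class_inv card_image_le)
  hence C: "card ?C \<le> 2 * card (conjugacy_class G x)"
    using card_Un_le[of "conjugacy_class G x" "conjugacy_class G (inv x)"] by linarith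
  have finC': "finite ?C" using finC x by (simp add: conjugacy_class_inv)
  have "{g. is_conj_product G {x} m g} \<subseteq>
    (\<lambda>hs. foldr (\<otimes>) hs \<one>) ` {hs. set hs \<subseteq> ?C \<and> length hs = m}"
    by (auto simp: is_conj_product_def)
  hence "card {g. is_conj_product G {x} m g} \<le> card {hs. set hs \<subseteq> ?C \<and> length hs = m}"
    by (rule surj_card_le[OF finite_lists_length_eq[OF finC']])
  also have "\<dots> = card ?C ^ m" using card_lists_length_eq[OF finC'] by simp
  also have "\<dots> \<le> (2 * card (conjugacy_class G x)) ^ m" using C by (rule power_mono) simp
  finally show ?thesis .
qed

text \<open>The lengths 0 to \<open>D\<close> cover the group. As \<open>c \<ge> 2\<close>, the
  geometric sum stays strictly below twice its last term, and this factor 2 is absorbed into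
  \<open>2 ^ D\<close> because \<open>D \<ge> 1\<close>; hence 4 instead of 2 in front of the class
  size.\<close>

lemma card_carrier_less:
  assumes fin: "finite (carrier G)" and x: "x \<in> carrier G" and D: "D \<ge> 1"
    and ball: "\<And>g. g \<in> carrier G \<Longrightarrow> g \<in> conj_ball G {x} D"
  shows "card (carrier G) < (4 * card (conjugacy_class G x)) ^ D"
proof -
  define c where "c = 2 * card (conjugacy_class G x)"
  have "x \<in> conjugacy_class G x"
    unfolding conjugacy_class_def using x r_one l_one by (auto intro!: exI[of _ \<one>])
  hence "card (conjugacy_class G x) > 0"
    using fin x conjugacy_class_closed finite_subset card_gt_0_iff by blast
  hence c: "c \<ge> 2" by (simp add: c_def)
  have sub: "carrier G \<subseteq> (\<Union>m\<in>{..D}. {g. is_conj_product G {x} m g})"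
    using ball by (auto simp: conj_ball_def)
  have "finite (\<Union>m\<in>{..D}. {g. is_conj_product G {x} m g})"
    using is_conj_product_closed[of "{x}"] x by (intro finite_subset[OF _ fin]) auto
  hence "card (carrier G) \<le> card (\<Union>m\<in>{..D}. {g. is_conj_product G {x} m g})"
    using sub by (rule card_mono)
  also have "\<dots> \<le> (\<Sum>m\<le>D. card {g. is_conj_product G {x} m g})"
    by (rule card_UN_le) (rule finite_atMost)
  also have "\<dots> \<le> (\<Sum>m\<le>D. c ^ m)"
    unfolding c_def by (intro sum_mono card_conj_products_le fin x)
  also have "\<dots> < 2 * c ^ D"
  proof (induction D)
    case 0
    thus ?case by simp
  next
    case (Suc D)
    have "2 * c ^ D \<le> c * c ^ D" by (rule mult_right_mono[OF c]) simp
    thus ?case using Suc unfolding sum.atMost_Suc power_Suc by linarith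
  qed
  also have "\<dots> \<le> 2 ^ D * c ^ D"
    using D by (intro mult_right_mono) (auto simp: self_le_power)
  also have "\<dots> = (4 * card (conjugacy_class G x)) ^ D"
    unfolding power_mult_distrib[symmetric] by (simp add: c_def)
  finally show ?thesis .
qed

end

text \<open>Homomorphisms map classes into classes and keep the number of factors. This moves bounds
  from the special linear group to its quotient.\<close>

lemma (in group_hom) is_conj_product_hom:
  assumes S: "S \<subseteq> carrier G" and g: "is_conj_product G S m g"
  shows "is_conj_product H (h ` S) m (h g)"
  using g
proof (induction m arbitrary: g)
  case 0
  thus ?case by (simp add: G.is_conj_product_0 H.is_conj_product_0)
next
  case (Suc m)
  then obtain y z s where *: "s \<in> S" "y \<in> conjugacy_class G s \<union> conjugacy_class G (inv s)"
    "is_conj_product G S m z" "g = y \<otimes> z"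
    by (auto simp only: G.is_conj_product_Suc)
  have s: "s \<in> carrier G" using * S by auto
  have cl: "h v \<in> conjugacy_class H (h t)" if "v \<in> conjugacy_class G t" "t \<in> carrier G" for v t
  proof -
    obtain a where "a \<in> carrier G" "v = a \<otimes> t \<otimes> inv a"
      using \<open>v \<in> _\<close> by (auto simp: conjugacy_class_def)
    hence "h a \<in> carrier H \<and> h v = h a \<otimes>\<^bsub>H\<^esub> h t \<otimes>\<^bsub>H\<^esub> inv\<^bsub>H\<^esub> h a"
      using \<open>t \<in> _\<close> by simp
    thus ?thesis by (auto simp: conjugacy_class_def)
  qed
  have "y \<in> carrier G" using *(2) s G.conjugacy_class_closed[of s] G.conjugacy_class_closed[of "inv s"] by auto
  hence "h g = h y \<otimes>\<^bsub>H\<^esub> h z" using * G.is_conj_product_closed[OF S] by auto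
  moreover have "h y \<in> conjugacy_class H (h s) \<union> conjugacy_class H (inv\<^bsub>H\<^esub> h s)"
    using *(2) s cl[of y s] cl[of y "inv s"] by auto
  ultimately show ?case using Suc.IH[OF *(3)] *(1) by (auto simp: H.is_conj_product_Suc)
qed

section \<open>Transvections\<close>

definition outer_prod :: "'a::semiring_0 vec \<Rightarrow> 'a vec \<Rightarrow> 'a mat" where
  "outer_prod u f = mat (dim_vec u) (dim_vec f) (\<lambda>(i, j). u $ i * f $ j)"

lemma outer_prod_carrier [simp, intro]:
  "u \<in> carrier_vec n \<Longrightarrow> f \<in> carrier_vec m \<Longrightarrow> outer_prod u f \<in> carrier_mat n m"
  by (auto simp: outer_prod_def)

lemma index_outer_prod [simp]:
  "i < dim_vec u \<Longrightarrow> j < dim_vec f \<Longrightarrow> outer_prod u f $$ (i, j) = u $ i * f $ j"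
  "dim_row (outer_prod u f) = dim_vec u" "dim_col (outer_prod u f) = dim_vec f"
  by (auto simp: outer_prod_def)

lemma row_outer_prod: "i < dim_vec u \<Longrightarrow> row (outer_prod u f) i = u $ i \<cdot>\<^sub>v f"
  by (intro eq_vecI) auto

lemma col_outer_prod: "j < dim_vec f \<Longrightarrow> col (outer_prod u f) j = f $ j \<cdot>\<^sub>v (u :: 'a::comm_semiring_0 vec)"
  by (intro eq_vecI) (auto simp: mult.commute)

lemma outer_prod_mult_vec:
  fixes u :: "'a::comm_semiring_0 vec"
  assumes "f \<in> carrier_vec n" "x \<in> carrier_vec n"
  shows "outer_prod u f *\<^sub>v x = (f \<bullet> x) \<cdot>\<^sub>v u"
  using assms by (intro eq_vecI) (auto simp: row_outer_prod mult.commute)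

lemma mult_outer_prod:
  fixes A :: "'a::comm_semiring_0 mat"
  assumes "A \<in> carrier_mat m n" "u \<in> carrier_vec n"
  shows "A * outer_prod u f = outer_prod (A *\<^sub>v u) f"
proof (intro eq_matI)
  fix i j
  assume "i < dim_row (outer_prod (A *\<^sub>v u) f)" "j < dim_col (outer_prod (A *\<^sub>v u) f)"
  thus "(A * outer_prod u f) $$ (i, j) = outer_prod (A *\<^sub>v u) f $$ (i, j)"
    using assms by (simp add: col_outer_prod mult.commute)
qed (use assms in auto)

lemma outer_prod_mult:
  fixes A :: "'a::comm_semiring_0 mat"
  assumes "A \<in> carrier_mat n m" "f \<in> carrier_vec n"
  shows "outer_prod u f * A = outer_prod u (A\<^sup>T *\<^sub>v f)"
proof (intro eq_matI)
  fix i j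
  assume "i < dim_row (outer_prod u (A\<^sup>T *\<^sub>v f))" "j < dim_col (outer_prod u (A\<^sup>T *\<^sub>v f))"
  thus "(outer_prod u f * A) $$ (i, j) = outer_prod u (A\<^sup>T *\<^sub>v f) $$ (i, j)"
    using assms comm_scalar_prod[of f n "col A j"] by (simp add: row_outer_prod)
qed (use assms in auto)

text \<open>The condition \<open>f \<bullet> u = 0\<close> is left to the lemmas, so that the
  formulas for products and for the action on vectors hold for every rank-one perturbation of the
  identity.\<close>

definition transv :: "nat \<Rightarrow> 'a::comm_ring_1 vec \<Rightarrow> 'a vec \<Rightarrow> 'a mat" where
  "transv n u f = 1\<^sub>m n + outer_prod u f"

lemma transv_carrier [simp, intro]:
  "u \<in> carrier_vec n \<Longrightarrow> f \<in> carrier_vec n \<Longrightarrow> transv n u f \<in> carrier_mat n n"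
  unfolding transv_def by auto

lemma transv_mult_vec:
  assumes "u \<in> carrier_vec n" "f \<in> carrier_vec n" "x \<in> carrier_vec n"
  shows "transv n u f *\<^sub>v x = x + (f \<bullet> x) \<cdot>\<^sub>v u"
proof -
  have "transv n u f *\<^sub>v x = 1\<^sub>m n *\<^sub>v x + outer_prod u f *\<^sub>v x"
    unfolding transv_def by (rule add_mult_distrib_mat_vec) (use assms in auto)
  thus ?thesis using assms by (simp add: outer_prod_mult_vec)
qed

lemma mult_transv:
  assumes "A \<in> carrier_mat n n" "u \<in> carrier_vec n" "f \<in> carrier_vec n"
  shows "A * transv n u f = A + outer_prod (A *\<^sub>v u) f"
proof -
  have "A * transv n u f = A * 1\<^sub>m n + A * outer_prod u f"
    unfolding transv_def by (rule mult_add_distrib_mat) (use assms in auto)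
  thus ?thesis using assms by (simp add: mult_outer_prod)
qed

lemma transv_mult:
  assumes "A \<in> carrier_mat n n" "u \<in> carrier_vec n" "f \<in> carrier_vec n"
  shows "transv n u f * A = A + outer_prod u (A\<^sup>T *\<^sub>v f)"
proof -
  have "transv n u f * A = 1\<^sub>m n * A + outer_prod u f * A"
    unfolding transv_def by (rule add_mult_distrib_mat) (use assms in auto)
  thus ?thesis using assms by (simp add: outer_prod_mult)
qed

text \<open>Sylvester's identity det(I + UF) = det(1 + FU). Multiplying the block matrices
  \<open>?L\<close> and \<open>?P\<close> in the two orders gives block upper triangular matrices
  with these determinants, and the order does not affect the determinant of the product.\<close>

lemma det_transv:
  fixes u f :: "'a::idom vec"
  assumes u: "u \<in> carrier_vec n" and f: "f \<in> carrier_vec n" and fu: "f \<bullet> u = 0"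
  shows "det (transv n u f) = 1"
proof -
  let ?U = "mat_of_cols n [u]" and ?F = "mat_of_rows n [f]"
  have U: "?U \<in> carrier_mat n 1" and F: "?F \<in> carrier_mat 1 n" by auto
  have UF: "?U * ?F = outer_prod u f"
    using u f by (intro eq_matI) (auto simp: scalar_prod_def mat_of_cols_def mat_of_rows_def)
  have FU: "?F * ?U = 0\<^sub>m 1 1"
    using u f fu by (intro eq_matI) (auto simp: scalar_prod_def mat_of_cols_def mat_of_rows_def)
  let ?P = "four_block_mat (1\<^sub>m 1) ?F (- ?U) (1\<^sub>m n)"
  let ?L = "four_block_mat (1\<^sub>m 1) (0\<^sub>m 1 n) ?U (1\<^sub>m n)"
  have P: "?P \<in> carrier_mat (1 + n) (1 + n)" and L: "?L \<in> carrier_mat (1 + n) (1 + n)"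
    by auto
  have "?L * ?P = four_block_mat (1\<^sub>m 1) ?F (0\<^sub>m n 1) (transv n u f)"
    by (subst mult_four_block_mat[of _ 1 1 _ n _ n _ _ 1 _ n])
       (use u f U F in \<open>auto simp: UF transv_def comm_add_mat[of _ n n]\<close>)
  hence 1: "det ?L * det ?P = det (transv n u f)"
    using det_mult[OF L P] det_four_block_mat_lower_left_zero[of "1\<^sub>m 1 :: 'a mat" 1 ?F n "0\<^sub>m n 1" "transv n u f"] u f F
    by simp
  have "?P * ?L = four_block_mat (1\<^sub>m 1) ?F (0\<^sub>m n 1) (1\<^sub>m n)"
    by (subst mult_four_block_mat[of _ 1 1 _ n _ n _ _ 1 _ n])
       (use U F in \<open>auto simp: FU\<close>)
  hence 2: "det ?P * det ?L = 1"
    using det_mult[OF P L] det_four_block_mat_lower_left_zero[of "1\<^sub>m 1 :: 'a mat" 1 ?F n "0\<^sub>m n 1" "1\<^sub>m n"] F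
    by simp
  show ?thesis using 1 2 by (simp add: mult.commute)
qed

section \<open>The special linear group and conjugation of transvections\<close>

lemma carrier_SL: "carrier (SL F n) = {A \<in> carrier_mat n n. det A = 1}"
  and mult_SL: "A \<otimes>\<^bsub>SL F n\<^esub> B = A * B"
  and one_SL: "\<one>\<^bsub>SL F n\<^esub> = 1\<^sub>m n"
  by (simp_all add: SL_def)

lemma group_SL: "group (SL F n)"
proof (rule groupI)
  fix A assume A: "A \<in> carrier (SL F n)"
  hence A': "A \<in> carrier_mat n n" "det A = 1" by (auto simp: carrier_SL)
  \<comment> \<open>With determinant 1 the adjugate is itself the inverse.\<close>
  have adj: "adj_mat A \<in> carrier_mat n n" "adj_mat A * A = 1\<^sub>m n"
    using adj_mat[OF A'(1)] A'(2) by auto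
  have "det (adj_mat A) = 1"
    using det_mult[OF adj(1) A'(1)] adj(2) A'(2) by simp
  thus "\<exists>B\<in>carrier (SL F n). B \<otimes>\<^bsub>SL F n\<^esub> A = \<one>\<^bsub>SL F n\<^esub>"
    using adj by (auto simp: carrier_SL mult_SL one_SL)
qed (auto simp: carrier_SL mult_SL one_SL det_mult[of _ n])

lemma transpose_SL: "A \<in> carrier (SL F n) \<Longrightarrow> A\<^sup>T \<in> carrier (SL F n)"
  by (auto simp: carrier_SL det_transpose)

lemma transv_SL:
  "u \<in> carrier_vec n \<Longrightarrow> f \<in> carrier_vec n \<Longrightarrow> f \<bullet> u = 0 \<Longrightarrow> transv n u f \<in> carrier (SL F n)"
  by (auto simp: carrier_SL det_transv)

text \<open>The left factor fixes \<open>u\<close>, so the functionals simply add. Inverses and the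
  second commutator below are computed from this.\<close>

lemma transv_mult_transv:
  fixes u f g :: "'a::comm_ring_1 vec"
  assumes "u \<in> carrier_vec n" "f \<in> carrier_vec n" "g \<in> carrier_vec n" "f \<bullet> u = 0"
  shows "transv n u f * transv n u g = transv n u (f + g)"
proof -
  have "transv n u f * transv n u g = transv n u f + outer_prod (transv n u f *\<^sub>v u) g"
    by (rule mult_transv) (use assms in auto)
  also have "transv n u f *\<^sub>v u = u"
    using assms by (simp add: transv_mult_vec) (intro eq_vecI, auto)
  also have "transv n u f + outer_prod u g = transv n u (f + g)"
    unfolding transv_def using assms by (intro eq_matI) (auto simp: algebra_simps)
  finally show ?thesis .
qed

lemma transv_zero: "u \<in> carrier_vec n \<Longrightarrow> transv n u (0\<^sub>v n) = 1\<^sub>m n"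
  unfolding transv_def by (intro eq_matI) auto

lemma inv_transv:
  fixes u f :: "'a::field vec"
  assumes "u \<in> carrier_vec n" "f \<in> carrier_vec n" "f \<bullet> u = 0"
  shows "inv\<^bsub>SL F n\<^esub> (transv n u f) = transv n u (- f)"
proof -
  interpret group "SL F n" by (rule group_SL)
  have "transv n u (- f) \<otimes>\<^bsub>SL F n\<^esub> transv n u f = transv n u (- f + f)"
    unfolding mult_SL by (rule transv_mult_transv) (use assms in auto)
  also have "- f + f = 0\<^sub>v n" using assms by auto
  finally have "transv n u (- f) \<otimes>\<^bsub>SL F n\<^esub> transv n u f = \<one>\<^bsub>SL F n\<^esub>"
    using assms by (simp add: transv_zero one_SL)
  moreover have "transv n u f \<in> carrier (SL F n)" "transv n u (- f) \<in> carrier (SL F n)"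
    using assms by (auto intro!: transv_SL)
  ultimately show ?thesis by (rule inv_equality)
qed

text \<open>Conjugation acts on the vector by \<open>M\<close> and on the functional by the inverse
  transpose, which preserves the pairing. Conjugating transvections thus means moving pairs of a
  vector and a functional.\<close>

lemma transv_conj:
  fixes u f :: "'a::field vec"
  assumes M: "M \<in> carrier (SL F n)"
    and u: "u \<in> carrier_vec n" and f: "f \<in> carrier_vec n" and fu: "f \<bullet> u = 0"
  shows "M \<otimes>\<^bsub>SL F n\<^esub> transv n u f \<otimes>\<^bsub>SL F n\<^esub> inv\<^bsub>SL F n\<^esub> M =
    transv n (M *\<^sub>v u) ((inv\<^bsub>SL F n\<^esub> M)\<^sup>T *\<^sub>v f)"
    and "((inv\<^bsub>SL F n\<^esub> M)\<^sup>T *\<^sub>v f) \<bullet> (M *\<^sub>v u) = 0"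
proof -
  interpret group "SL F n" by (rule group_SL)
  let ?N = "inv\<^bsub>SL F n\<^esub> M"
  have M': "M \<in> carrier_mat n n" using M by (auto simp: carrier_SL)
  have N: "?N \<in> carrier_mat n n" using M inv_closed[of M] unfolding carrier_SL by blast
  have MN: "M * ?N = 1\<^sub>m n" "?N * M = 1\<^sub>m n"
    using M r_inv[of M] l_inv[of M] by (auto simp: mult_SL one_SL)
  have "M * transv n u f * ?N = M * (transv n u f * ?N)"
    using M' N u f by (intro assoc_mult_mat) auto
  also have "transv n u f * ?N = ?N + outer_prod u (?N\<^sup>T *\<^sub>v f)"
    using N u f by (rule transv_mult)
  also have "M * \<dots> = M * ?N + M * outer_prod u (?N\<^sup>T *\<^sub>v f)"
    by (rule mult_add_distrib_mat) (use M' N u f in auto)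
  also have "\<dots> = transv n (M *\<^sub>v u) (?N\<^sup>T *\<^sub>v f)"
    using M' u by (simp add: MN mult_outer_prod transv_def)
  finally show "M \<otimes>\<^bsub>SL F n\<^esub> transv n u f \<otimes>\<^bsub>SL F n\<^esub> ?N = transv n (M *\<^sub>v u) (?N\<^sup>T *\<^sub>v f)"
    by (simp add: mult_SL)
  have "(?N\<^sup>T *\<^sub>v f) \<bullet> (M *\<^sub>v u) = f \<bullet> (?N *\<^sub>v (M *\<^sub>v u))"
    by (rule transpose_vec_mult_scalar) (use N M' u f in auto)
  also have "?N *\<^sub>v (M *\<^sub>v u) = (?N * M) *\<^sub>v u" using N M' u by simp
  finally show "(?N\<^sup>T *\<^sub>v f) \<bullet> (M *\<^sub>v u) = 0" using MN u fu by simp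
qed

text \<open>Elements of \<open>T\<close>, their inverses and all conjugates of these lie in the
  \<open>k\<close>-ball of \<open>S\<close>, so each factor may be replaced by at most
  \<open>k\<close> factors.\<close>

lemma (in group) conj_ball_trans:
  assumes S: "S \<subseteq> carrier G" and T: "T \<subseteq> conj_ball G S k"
  shows "conj_ball G T m \<subseteq> conj_ball G S (k * m)"
proof -
  have Tc: "T \<subseteq> carrier G" using T conj_ball_closed[OF S] by blast
  have "g \<in> conj_ball G S (k * i)" if "is_conj_product G T i g" for i g
    using that
  proof (induction i arbitrary: g)
    case 0
    thus ?case by (simp add: is_conj_product_0 conj_ball_one)
  next
    case (Suc i)
    then obtain y z t where *: "t \<in> T" "y \<in> conjugacy_class G t \<union> conjugacy_class G (inv t)"
      "is_conj_product G T i z" "g = y \<otimes> z"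
      by (auto simp only: is_conj_product_Suc)
    have "t \<in> conj_ball G S k" "inv t \<in> conj_ball G S k"
      using T *(1) conj_ball_inv[OF S] by auto
    hence "y \<in> conj_ball G S k"
      using *(2) conj_ball_conj[OF S] unfolding conjugacy_class_def by blast
    thus ?case using conj_ball_mult[OF S _ Suc.IH[OF *(3)]] *(4) by auto
  qed
  moreover have "conj_ball G S (k * i) \<subseteq> conj_ball G S (k * m)" if "i \<le> m" for i
    using that by (intro conj_ball_mono) simp
  ultimately show ?thesis unfolding conj_ball_def[of G T] by blast
qed

section \<open>Column elimination by transvections\<close>

definition transvs :: "nat \<Rightarrow> 'a::comm_ring_1 mat set" where
  "transvs n = {transv n u f | u f. u \<in> carrier_vec n \<and> f \<in> carrier_vec n \<and> f \<bullet> u = 0}"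

lemma transvs_subset: "transvs n \<subseteq> carrier (SL F n)"
  by (auto simp: transvs_def intro: transv_SL)

lemma transpose_transv:
  assumes "u \<in> carrier_vec n" "f \<in> carrier_vec n"
  shows "(transv n u f)\<^sup>T = transv n f u"
  unfolding transv_def using assms by (intro eq_matI) (auto simp: mult.commute)

text \<open>
  The clause on \<open>w $ j = 0\<close> says that the elimination leaves coordinate \<open>j\<close> of every vector
  unchanged; it is what allows \<open>u\<close> and \<open>f\<close> to be normalised one after the other when conjugating
  a transvection to standard form.
\<close>

lemma clear_column_step:
  fixes w :: "'a::field vec"
  assumes w: "w \<in> carrier_vec n" and k: "k < n"
    and i: "k \<le> i" "i < n" "w $ i \<noteq> 0" "k < i \<or> w $ k = 1"
  shows "\<exists>T\<in>transvs n. T *\<^sub>v w = unit_vec n k \<and>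
    (\<forall>j<k. T *\<^sub>v unit_vec n j = unit_vec n j \<and>
      (w $ j = 0 \<longrightarrow> T\<^sup>T *\<^sub>v unit_vec n j = unit_vec n j))"
proof -
  \<comment> \<open>The coefficient \<open>c\<close> makes \<open>f \<bullet> w = 1\<close>, so the
    transvection adds exactly \<open>u\<close> to \<open>w\<close> and reaches
    \<open>unit_vec n k\<close>. As \<open>f $ k = 1\<close> too, \<open>f\<close> vanishes on the
    difference \<open>u\<close>. Its support lies in coordinates from \<open>k\<close> on, so
    earlier unit vectors are fixed.\<close>
  define c where "c = (if w $ k = 1 then 0 else (1 - w $ k) / w $ i)"
  define f where "f = unit_vec n k + c \<cdot>\<^sub>v unit_vec n i"
  define u where "u = unit_vec n k - w"
  have f: "f \<in> carrier_vec n" and u: "u \<in> carrier_vec n" using w by (auto simp: f_def u_def)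
  have fw: "f \<bullet> w = 1"
    using w k i by (simp add: f_def c_def add_scalar_prod_distrib[of _ n])
  have fk: "f $ k = 1" using k i by (auto simp: f_def c_def)
  have fj: "f $ j = 0" if "j < k" for j using that k i by (auto simp: f_def)
  have fu: "f \<bullet> u = 0"
    using f w k by (simp add: u_def scalar_prod_minus_distrib[of _ n] fw fk)
  show ?thesis
  proof (intro bexI[of _ "transv n u f"] conjI allI impI)
    show "transv n u f \<in> transvs n" using u f fu by (auto simp: transvs_def)
    show "transv n u f *\<^sub>v w = unit_vec n k"
      using u f w by (simp add: transv_mult_vec fw) (auto simp: u_def intro!: eq_vecI)
    show "transv n u f *\<^sub>v unit_vec n j = unit_vec n j" if "j < k" for j
      using u f that k fj by (simp add: transv_mult_vec) (auto intro!: eq_vecI)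
    \<comment> \<open>Transposition exchanges \<open>u\<close> and \<open>f\<close>, so now
      coordinate \<open>j\<close> of \<open>u\<close> decides; for \<open>j < k\<close> it is
      \<open>- w $ j\<close>.\<close>
    show "(transv n u f)\<^sup>T *\<^sub>v unit_vec n j = unit_vec n j" if "j < k" "w $ j = 0" for j
    proof -
      have "u $ j = 0" using that k w by (simp add: u_def)
      thus ?thesis
        using u f that k by (simp add: transpose_transv transv_mult_vec) (auto intro!: eq_vecI)
    qed
  qed
qed

text \<open>One step suffices unless \<open>w $ k\<close> is the only nonzero entry from
  \<open>k\<close> on and differs from 1. Then a preliminary transvection \<open>E\<close> first
  copies it into coordinate \<open>Suc k\<close>, for which there must be room.\<close>

lemma clear_column:
  fixes w :: "'a::field vec"
  assumes w: "w \<in> carrier_vec n" and k: "k < n"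
    and i: "k \<le> i" "i < n" "w $ i \<noteq> 0" "Suc k < n \<or> w $ k = 1"
  shows "\<exists>M\<in>conj_ball (SL TYPE('a) n) (transvs n) 2. M *\<^sub>v w = unit_vec n k \<and>
    (\<forall>j<k. M *\<^sub>v unit_vec n j = unit_vec n j \<and>
      (w $ j = 0 \<longrightarrow> M\<^sup>T *\<^sub>v unit_vec n j = unit_vec n j))"
proof -
  interpret group "SL TYPE('a) n" by (rule group_SL)
  have one: "T \<in> conj_ball (SL TYPE('a) n) (transvs n) 1" if "T \<in> transvs n" for T
    using that by (intro conj_ball_generator transvs_subset)
  show ?thesis
  proof (cases "w $ k = 1 \<or> (\<exists>i. k < i \<and> i < n \<and> w $ i \<noteq> 0)")
    case True
    hence "\<exists>i'. k \<le> i' \<and> i' < n \<and> w $ i' \<noteq> 0 \<and> (k < i' \<or> w $ k = 1)"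
    proof
      assume "w $ k = 1"
      thus ?thesis using k by (intro exI[of _ k]) simp
    qed (use less_imp_le in blast)
    then obtain i' where "k \<le> i'" "i' < n" "w $ i' \<noteq> 0" "k < i' \<or> w $ k = 1" by blast
    from clear_column_step[OF w k this] obtain T where T: "T \<in> transvs n" "T *\<^sub>v w = unit_vec n k"
      "\<forall>j<k. T *\<^sub>v unit_vec n j = unit_vec n j \<and>
        (w $ j = 0 \<longrightarrow> T\<^sup>T *\<^sub>v unit_vec n j = unit_vec n j)"
      by blast
    show ?thesis
      using T(2,3) subsetD[OF conj_ball_mono one[OF T(1)], of 2] by auto
  next
    case False
    hence k': "Suc k < n" using i(4) by blast
    have 0: "w $ j = 0" if "k < j" "j < n" for j using False that by blast
    hence wk: "w $ k \<noteq> 0" using i by (metis le_neq_implies_less)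
    define E where "E = transv n (unit_vec n (Suc k)) (unit_vec n k :: 'a vec)"
    have E: "E \<in> transvs n" unfolding E_def transvs_def using k k' by fastforce
    have Ec: "E \<in> carrier_mat n n" by (simp add: E_def)
    define w' where "w' = E *\<^sub>v w"
    have w'_eq: "w' = w + (w $ k) \<cdot>\<^sub>v unit_vec n (Suc k)"
      unfolding w'_def E_def using w k by (simp add: transv_mult_vec)
    have w': "w' \<in> carrier_vec n" using w by (simp add: w'_eq)
    have w's: "w' $ Suc k \<noteq> 0" using w k' wk 0[of "Suc k"] by (simp add: w'_eq)
    \<comment> \<open>Earlier coordinates are untouched, so the condition \<open>w $ j = 0\<close>
      carries over to the second step.\<close>
    have w'j: "w' $ j = w $ j" if "j < k" for j using that k k' w by (simp add: w'_eq)
    obtain T where T: "T \<in> transvs n" "T *\<^sub>v w' = unit_vec n k"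
      "\<forall>j<k. T *\<^sub>v unit_vec n j = unit_vec n j \<and>
        (w' $ j = 0 \<longrightarrow> T\<^sup>T *\<^sub>v unit_vec n j = unit_vec n j)"
      using clear_column_step[OF w' k le_SucI[OF order_refl] k' w's] by blast
    have Tc: "T \<in> carrier_mat n n" using T(1) by (auto simp: transvs_def)
    show ?thesis
    proof (intro bexI[of _ "T * E"] conjI allI impI)
      show "T * E \<in> conj_ball (SL TYPE('a) n) (transvs n) 2"
        using conj_ball_mult[OF transvs_subset one[OF T(1)] one[OF E]] by (simp add: mult_SL numeral_2_eq_2)
      show "(T * E) *\<^sub>v w = unit_vec n k"
        using T(2) Tc Ec w by (simp add: w'_def)
      show "(T * E) *\<^sub>v unit_vec n j = unit_vec n j" if "j < k" for j
      proof -
        have "E *\<^sub>v unit_vec n j = unit_vec n j"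
          unfolding E_def using that k by (simp add: transv_mult_vec) (auto intro!: eq_vecI)
        thus ?thesis using T(3) that Tc Ec by simp
      qed
      show "(T * E)\<^sup>T *\<^sub>v unit_vec n j = unit_vec n j" if "j < k" "w $ j = 0" for j
      proof -
        have "E\<^sup>T *\<^sub>v unit_vec n j = unit_vec n j"
          unfolding E_def using that k k'
          by (simp add: transpose_transv transv_mult_vec) (auto intro!: eq_vecI)
        moreover have "T\<^sup>T *\<^sub>v unit_vec n j = unit_vec n j" using T(3) that w'j by simp
        moreover have "(T * E)\<^sup>T = E\<^sup>T * T\<^sup>T" using Tc Ec by (rule transpose_mult)
        ultimately show ?thesis using Tc Ec by simp
      qed
    qed
  qed
qed

section \<open>Generation by transvections\<close>

lemma SL_inverse:
  assumes "A \<in> carrier (SL F n)"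
  shows "A \<in> carrier_mat n n" "inv\<^bsub>SL F n\<^esub> A \<in> carrier_mat n n"
    "A * inv\<^bsub>SL F n\<^esub> A = 1\<^sub>m n" "inv\<^bsub>SL F n\<^esub> A * A = 1\<^sub>m n"
proof -
  interpret group "SL F n" by (rule group_SL)
  show "A \<in> carrier_mat n n" using assms by (auto simp: carrier_SL)
  show "inv\<^bsub>SL F n\<^esub> A \<in> carrier_mat n n" using inv_closed[OF assms] unfolding carrier_SL by blast
  show "A * inv\<^bsub>SL F n\<^esub> A = 1\<^sub>m n" "inv\<^bsub>SL F n\<^esub> A * A = 1\<^sub>m n"
    using r_inv[OF assms] l_inv[OF assms] by (simp_all add: mult_SL one_SL)
qed

lemma SL_mult_vec_inj:
  assumes A: "A \<in> carrier (SL F n)" and x: "x \<in> carrier_vec n" "y \<in> carrier_vec n" and eq: "A *\<^sub>v x = A *\<^sub>v y"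
  shows "x = y"
proof -
  let ?B = "inv\<^bsub>SL F n\<^esub> A"
  note * = SL_inverse[OF A]
  have "x = (?B * A) *\<^sub>v x" using * x by simp
  also have "\<dots> = ?B *\<^sub>v (A *\<^sub>v y)"
    unfolding eq[symmetric] by (rule assoc_mult_mat_vec[OF *(2,1) x(1)])
  also have "\<dots> = (?B * A) *\<^sub>v y"
    by (rule assoc_mult_mat_vec[OF *(2,1) x(2), symmetric])
  finally show ?thesis using * x by simp
qed

lemma mult_unit_vec:
  fixes A :: "'a::semiring_1 mat"
  shows "A \<in> carrier_mat m n \<Longrightarrow> j < n \<Longrightarrow> A *\<^sub>v unit_vec n j = col A j"
  by (intro eq_vecI) auto

lemma mat_eq_of_unit_vec:
  fixes A :: "'a::semiring_1 mat"
  assumes "A \<in> carrier_mat m n" "B \<in> carrier_mat m n"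
    and "\<And>j. j < n \<Longrightarrow> A *\<^sub>v unit_vec n j = B *\<^sub>v unit_vec n j"
  shows "A = B"
proof (rule mat_col_eqI)
  fix j assume "j < dim_col B"
  thus "col A j = col B j" using assms mult_unit_vec by (metis carrier_matD(2))
qed (use assms in auto)

text \<open>Such an \<open>x\<close> lies in the span of the fixed unit vectors. This will show that
  the next column has a nonzero entry on or below the diagonal.\<close>

lemma fixes_lower_support:
  fixes A :: "'a::semiring_1 mat"
  assumes A: "A \<in> carrier_mat n n" and fix_: "\<And>j. j < k \<Longrightarrow> A *\<^sub>v unit_vec n j = unit_vec n j"
    and x: "x \<in> carrier_vec n" "\<And>j. k \<le> j \<Longrightarrow> j < n \<Longrightarrow> x $ j = 0"
  shows "A *\<^sub>v x = x"
proof (intro eq_vecI)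
  fix i assume i: "i < dim_vec x"
  have "A $$ (i, j) * x $ j = (if j = i then x $ j else 0)" if "j < n" for j
  proof (cases "j < k")
    case True
    have "A $$ (i, j) = col A j $ i" using i x A that by simp
    also have "\<dots> = (A *\<^sub>v unit_vec n j) $ i" using mult_unit_vec[OF A that] by simp
    also have "\<dots> = unit_vec n j $ i" by (simp only: fix_[OF True])
    finally show ?thesis using i x that by simp
  qed (use x that in auto)
  hence "(A *\<^sub>v x) $ i = (\<Sum>j = 0..<n. if j = i then x $ j else 0)"
    using i x A by (auto simp: scalar_prod_def intro!: sum.cong)
  thus "(A *\<^sub>v x) $ i = x $ i" using i x by simp
qed (use A x in auto)

text \<open>\<open>A\<close> is upper triangular with all diagonal entries but the last equal to 1,
  so the last one is the determinant. It saves one transvection in the final column.\<close>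

lemma last_entry_1:
  fixes A :: "'a::field mat"
  assumes A: "A \<in> carrier (SL F (Suc k))" and fix_: "\<And>j. j < k \<Longrightarrow> A *\<^sub>v unit_vec (Suc k) j = unit_vec (Suc k) j"
  shows "A $$ (k, k) = 1"
proof -
  have Ac: "A \<in> carrier_mat (Suc k) (Suc k)" "det A = 1" using A by (auto simp: carrier_SL)
  have ent: "A $$ (i, j) = (if i = j then 1 else 0)" if "j < k" "i < Suc k" for i j
  proof -
    have "A $$ (i, j) = col A j $ i" using Ac that by simp
    also have "\<dots> = (A *\<^sub>v unit_vec (Suc k) j) $ i" using mult_unit_vec[OF Ac(1), of j] that by simp
    also have "\<dots> = unit_vec (Suc k) j $ i" by (simp only: fix_[OF that(1)])
    finally show ?thesis using that by simp
  qed
  have "upper_triangular A" using Ac ent by (auto simp: upper_triangular_def)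
  hence "1 = prod_list (diag_mat A)" using det_upper_triangular Ac by metis
  also have "diag_mat A = map (\<lambda>i. 1) [0..<k] @ [A $$ (k, k)]"
    using Ac ent by (auto simp: diag_mat_def)
  also have "prod_list \<dots> = A $$ (k, k)" by (simp add: prod_list_replicate map_replicate_const)
  finally show ?thesis by simp
qed

text \<open>The first \<open>k\<close> columns are already cleared and \<open>d + 1\<close> remain.
  Each costs two transvections, except the last, whose diagonal entry is 1 and which costs one.
  Writing the dimension as \<open>Suc (k + d)\<close> keeps it fixed while \<open>k\<close> grows
  and \<open>d\<close> shrinks.\<close>

lemma SL_transv_generation:
  fixes A :: "'a::field mat"
  assumes "A \<in> carrier (SL TYPE('a) (Suc (k + d)))"
    and "\<And>j. j < k \<Longrightarrow> A *\<^sub>v unit_vec (Suc (k + d)) j = unit_vec (Suc (k + d)) j"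
  shows "A \<in> conj_ball (SL TYPE('a) (Suc (k + d))) (transvs (Suc (k + d))) (2 * d + 1)"
  using assms
proof (induction d arbitrary: k A)
  case 0
  define n where "n = Suc k"
  have A: "A \<in> carrier (SL TYPE('a) n)" and fix_: "\<And>j. j < k \<Longrightarrow> A *\<^sub>v unit_vec n j = unit_vec n j"
    using 0 by (auto simp: n_def)
  interpret group "SL TYPE('a) n" by (rule group_SL)
  note Ac = SL_inverse(1)[OF A]
  let ?w = "A *\<^sub>v unit_vec n k"
  have "?w $ k = 1"
    using last_entry_1[of A _ k] A fix_ Ac mult_unit_vec[OF Ac, of k] by (auto simp: n_def)
  hence "?w \<in> carrier_vec n" "k < n" "k \<le> k" "k < n" "?w $ k \<noteq> 0" "k < k \<or> ?w $ k = 1"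
    using Ac by (auto simp: n_def)
  from clear_column_step[OF this] obtain T where T: "T \<in> transvs n" "T *\<^sub>v ?w = unit_vec n k"
    "\<forall>j<k. T *\<^sub>v unit_vec n j = unit_vec n j" by blast
  have Ts: "T \<in> carrier (SL TYPE('a) n)" using T(1) transvs_subset by blast
  have "T * A = 1\<^sub>m n"
  proof (rule mat_eq_of_unit_vec)
    fix j assume "j < n"
    hence "j < k \<or> j = k" by (auto simp: n_def)
    thus "(T * A) *\<^sub>v unit_vec n j = 1\<^sub>m n *\<^sub>v unit_vec n j"
      using T fix_ Ac SL_inverse(1)[OF Ts] by auto
  qed (use Ac SL_inverse(1)[OF Ts] in auto)
  hence "A \<otimes>\<^bsub>SL TYPE('a) n\<^esub> T = \<one>\<^bsub>SL TYPE('a) n\<^esub>"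
    using Ts A by (intro inv_comm[of T A]) (simp_all only: mult_SL one_SL)
  hence "inv\<^bsub>SL TYPE('a) n\<^esub> T = A" using inv_equality Ts A by blast
  thus ?case
    using conj_ball_inv[OF transvs_subset conj_ball_generator[OF transvs_subset T(1)]] by (simp add: n_def)
next
  case (Suc d)
  define n where "n = Suc (k + Suc d)"
  have A: "A \<in> carrier (SL TYPE('a) n)" and fix_: "\<And>j. j < k \<Longrightarrow> A *\<^sub>v unit_vec n j = unit_vec n j"
    using Suc.prems by (auto simp: n_def)
  interpret group "SL TYPE('a) n" by (rule group_SL)
  note Ac = SL_inverse(1)[OF A]
  let ?w = "A *\<^sub>v unit_vec n k"
  have w: "?w \<in> carrier_vec n" and k: "k < n" using Ac by (auto simp: n_def)
  \<comment> \<open>Otherwise the column \<open>?w\<close> would be fixed by \<open>A\<close>; since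
    \<open>A\<close> also sends \<open>unit_vec n k\<close> to \<open>?w\<close>, injectivity would
    give \<open>?w = unit_vec n k\<close>, whose entry \<open>k\<close> is not 0.\<close>
  have "\<exists>i. k \<le> i \<and> i < n \<and> ?w $ i \<noteq> 0"
  proof (rule ccontr)
    assume "\<not> ?thesis"
    hence 0: "\<And>j. k \<le> j \<Longrightarrow> j < n \<Longrightarrow> ?w $ j = 0" by blast
    have "A *\<^sub>v ?w = ?w" using fixes_lower_support[OF Ac fix_ w 0] .
    hence "?w = unit_vec n k" using SL_mult_vec_inj[OF A w] by auto
    thus False using 0[of k] k by simp
  qed
  then obtain i where i: "k \<le> i" "i < n" "?w $ i \<noteq> 0" by blast
  have "Suc k < n \<or> ?w $ k = 1" by (simp add: n_def)
  from clear_column[OF w k i this] obtain M where M: "M \<in> conj_ball (SL TYPE('a) n) (transvs n) 2"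
    "M *\<^sub>v ?w = unit_vec n k" "\<forall>j<k. M *\<^sub>v unit_vec n j = unit_vec n j" by blast
  have Ms: "M \<in> carrier (SL TYPE('a) n)" using M(1) conj_ball_closed[OF transvs_subset] by blast
  have MA: "M * A \<in> carrier (SL TYPE('a) n)" using m_closed[OF Ms A] by (simp add: mult_SL)
  have "(M * A) *\<^sub>v unit_vec n j = unit_vec n j" if "j < Suc k" for j
    using that M fix_ Ac SL_inverse(1)[OF Ms] by (cases "j = k") auto
  hence "M * A \<in> conj_ball (SL TYPE('a) n) (transvs n) (2 * d + 1)"
    using Suc.IH[of "M * A" "Suc k"] MA by (simp add: n_def)
  from conj_ball_mult[OF transvs_subset conj_ball_inv[OF transvs_subset M(1)] this]
  have "inv\<^bsub>SL TYPE('a) n\<^esub> M \<otimes>\<^bsub>SL TYPE('a) n\<^esub> (M \<otimes>\<^bsub>SL TYPE('a) n\<^esub> A)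
      \<in> conj_ball (SL TYPE('a) n) (transvs n) (2 * Suc d + 1)"
    by (simp add: mult_SL)
  also have "inv\<^bsub>SL TYPE('a) n\<^esub> M \<otimes>\<^bsub>SL TYPE('a) n\<^esub> (M \<otimes>\<^bsub>SL TYPE('a) n\<^esub> A) = A"
    using Ms A by (simp add: m_assoc[symmetric])
  finally show ?case by (simp add: n_def)
qed

text \<open>First the vector is moved to \<open>unit_vec n 0\<close>, then the functional to
  \<open>unit_vec n 1\<close> by an element keeping \<open>unit_vec n 0\<close>. The second move
  eliminates at column 1, where \<open>Suc 1 < n\<close> is the hypothesis
  \<open>n \<ge> 3\<close>.\<close>

lemma transv_conj_standard:
  fixes u f :: "'a::field vec"
  assumes n: "n \<ge> 3" and u: "u \<in> carrier_vec n" "u \<noteq> 0\<^sub>v n" and f: "f \<in> carrier_vec n" "f \<noteq> 0\<^sub>v n"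
    and fu: "f \<bullet> u = 0"
  obtains M where "M \<in> carrier (SL TYPE('a) n)"
    "M \<otimes>\<^bsub>SL TYPE('a) n\<^esub> transv n u f \<otimes>\<^bsub>SL TYPE('a) n\<^esub> inv\<^bsub>SL TYPE('a) n\<^esub> M =
      transv n (unit_vec n 0) (unit_vec n 1)"
proof -
  let ?G = "SL TYPE('a) n"
  interpret group ?G by (rule group_SL)
  have cb: "M \<in> carrier ?G" if "M \<in> conj_ball ?G (transvs n) 2" for M
    using that conj_ball_closed[OF transvs_subset] by blast
  obtain i where "i < n" "u $ i \<noteq> 0" using u by (metis carrier_vecD eq_vecI index_zero_vec)
  then obtain M1 where "M1 \<in> conj_ball ?G (transvs n) 2" "M1 *\<^sub>v u = unit_vec n 0"
    using clear_column[OF u(1), of 0 i] n by auto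
  hence M1: "M1 \<in> carrier ?G" "M1 *\<^sub>v u = unit_vec n 0" using cb by blast+
  let ?N1 = "inv\<^bsub>?G\<^esub> M1"
  note M1' = SL_inverse[OF M1(1)]
  define f1 where "f1 = ?N1\<^sup>T *\<^sub>v f"
  have f1: "f1 \<in> carrier_vec n" using M1' f by (simp add: f1_def)
  have c1: "M1 \<otimes>\<^bsub>?G\<^esub> transv n u f \<otimes>\<^bsub>?G\<^esub> ?N1 = transv n (unit_vec n 0) f1"
    and f1u: "f1 \<bullet> unit_vec n 0 = 0"
    using transv_conj[OF M1(1) u(1) f(1) fu] M1(2) by (auto simp: f1_def)
  have f10: "f1 $ 0 = 0" using f1u f1 n by simp
  have "f1 \<noteq> 0\<^sub>v n"
  proof
    assume "f1 = 0\<^sub>v n"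
    hence "?N1\<^sup>T *\<^sub>v f = ?N1\<^sup>T *\<^sub>v 0\<^sub>v n" using M1' by (auto simp: f1_def)
    thus False using SL_mult_vec_inj[OF transpose_SL[OF inv_closed[OF M1(1)]] f(1)] f(2) by auto
  qed
  then obtain i where i: "i < n" "f1 $ i \<noteq> 0" using f1 by (metis carrier_vecD eq_vecI index_zero_vec)
  hence "1 \<le> i" using f10 by (cases i) auto
  \<comment> \<open>Since \<open>f1 $ 0 = 0\<close>, the transpose clause of
    \<open>clear_column\<close> gives that \<open>N\<^sup>T\<close> fixes
    \<open>unit_vec n 0\<close>.\<close>
  then obtain N where "N \<in> conj_ball ?G (transvs n) 2" "N *\<^sub>v f1 = unit_vec n 1"
    "N\<^sup>T *\<^sub>v unit_vec n 0 = unit_vec n 0"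
    using clear_column[OF f1, of 1 i] i n f10 by auto
  hence N: "N \<in> carrier ?G" "N *\<^sub>v f1 = unit_vec n 1" "N\<^sup>T *\<^sub>v unit_vec n 0 = unit_vec n 0"
    using cb by blast+
  have NT: "N\<^sup>T \<in> carrier ?G" using N(1) by (rule transpose_SL)
  note NT' = SL_inverse[OF NT]
  \<comment> \<open>Conjugation by \<open>M2\<close> acts on functionals by its inverse transpose,
    so this choice makes it act there as \<open>N\<close> itself.\<close>
  define M2 where "M2 = inv\<^bsub>?G\<^esub> (N\<^sup>T)"
  have M2: "M2 \<in> carrier ?G" "inv\<^bsub>?G\<^esub> M2 = N\<^sup>T" using NT by (auto simp: M2_def)
  have "M2 *\<^sub>v (N\<^sup>T *\<^sub>v unit_vec n 0) = (M2 * N\<^sup>T) *\<^sub>v unit_vec n 0"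
    unfolding M2_def by (rule assoc_mult_mat_vec[OF NT'(2,1), symmetric]) simp
  hence M20: "M2 *\<^sub>v unit_vec n 0 = unit_vec n 0" using N(3) NT' by (simp add: M2_def)
  have u0: "unit_vec n 0 \<in> carrier_vec n" by simp
  have c2: "M2 \<otimes>\<^bsub>?G\<^esub> transv n (unit_vec n 0) f1 \<otimes>\<^bsub>?G\<^esub> inv\<^bsub>?G\<^esub> M2 = transv n (unit_vec n 0) (unit_vec n 1)"
    using transv_conj(1)[OF M2(1) u0 f1 f1u] M20 N(2) by (simp add: M2(2))
  have T: "transv n u f \<in> carrier ?G" using u f fu by (intro transv_SL)
  have "(M2 \<otimes>\<^bsub>?G\<^esub> M1) \<otimes>\<^bsub>?G\<^esub> transv n u f \<otimes>\<^bsub>?G\<^esub> inv\<^bsub>?G\<^esub> (M2 \<otimes>\<^bsub>?G\<^esub> M1) =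
      M2 \<otimes>\<^bsub>?G\<^esub> (M1 \<otimes>\<^bsub>?G\<^esub> transv n u f \<otimes>\<^bsub>?G\<^esub> ?N1) \<otimes>\<^bsub>?G\<^esub> inv\<^bsub>?G\<^esub> M2"
    using M1(1) M2(1) T by (simp add: m_assoc inv_mult_group)
  thus ?thesis using that[of "M2 \<otimes>\<^bsub>?G\<^esub> M1"] M1(1) M2(1) c1 c2 by simp
qed

section \<open>Transvections as products of conjugates\<close>

text \<open>Balls are invariant under conjugation, and any two nontrivial transvections are
  conjugate through the standard one. The trivial ones equal the identity, which lies in every
  ball.\<close>

lemma transvs_subset_conj_ball:
  fixes u f :: "'a::field vec"
  assumes n: "n \<ge> 3" and S: "S \<subseteq> carrier (SL TYPE('a) n)"
    and u: "u \<in> carrier_vec n" "u \<noteq> 0\<^sub>v n" and f: "f \<in> carrier_vec n" "f \<noteq> 0\<^sub>v n"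
    and fu: "f \<bullet> u = 0" and T: "transv n u f \<in> conj_ball (SL TYPE('a) n) S k"
  shows "transvs n \<subseteq> conj_ball (SL TYPE('a) n) S k"
proof
  let ?G = "SL TYPE('a) n"
  interpret group ?G by (rule group_SL)
  fix X :: "'a mat" assume "X \<in> transvs n"
  then obtain v g where X: "X = transv n v g" "v \<in> carrier_vec n" "g \<in> carrier_vec n" "g \<bullet> v = 0"
    by (auto simp: transvs_def)
  show "X \<in> conj_ball ?G S k"
  proof (cases "v = 0\<^sub>v n \<or> g = 0\<^sub>v n")
    case True
    hence "X = 1\<^sub>m n" using X transv_zero[of v n] by (auto simp: transv_def intro!: eq_matI)
    thus ?thesis using conj_ball_one[of S k] by (simp add: one_SL)
  next
    case False
    from transv_conj_standard[OF n u f fu] obtain M where M: "M \<in> carrier ?G"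
      "M \<otimes>\<^bsub>?G\<^esub> transv n u f \<otimes>\<^bsub>?G\<^esub> inv\<^bsub>?G\<^esub> M = transv n (unit_vec n 0) (unit_vec n 1)" .
    from False have vg: "v \<noteq> 0\<^sub>v n" "g \<noteq> 0\<^sub>v n" by auto
    from transv_conj_standard[OF n X(2) vg(1) X(3) vg(2) X(4)] obtain N where N: "N \<in> carrier ?G"
      "N \<otimes>\<^bsub>?G\<^esub> X \<otimes>\<^bsub>?G\<^esub> inv\<^bsub>?G\<^esub> N = transv n (unit_vec n 0) (unit_vec n 1)"
      unfolding X(1) .
    have Xc: "X \<in> carrier ?G" unfolding X(1) using X by (intro transv_SL)
    have "inv\<^bsub>?G\<^esub> N \<otimes>\<^bsub>?G\<^esub> (N \<otimes>\<^bsub>?G\<^esub> X \<otimes>\<^bsub>?G\<^esub> inv\<^bsub>?G\<^esub> N) \<otimes>\<^bsub>?G\<^esub> inv\<^bsub>?G\<^esub> (inv\<^bsub>?G\<^esub> N) \<in> conj_ball ?G S k"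
      unfolding N(2) using conj_ball_conj[OF S conj_ball_conj[OF S T M(1)], of "inv\<^bsub>?G\<^esub> N"] N(1)
      unfolding M(2) by simp
    also have "inv\<^bsub>?G\<^esub> N \<otimes>\<^bsub>?G\<^esub> (N \<otimes>\<^bsub>?G\<^esub> X \<otimes>\<^bsub>?G\<^esub> inv\<^bsub>?G\<^esub> N) \<otimes>\<^bsub>?G\<^esub> inv\<^bsub>?G\<^esub> (inv\<^bsub>?G\<^esub> N) = X"
      using N(1) Xc by (simp add: m_assoc) (simp add: m_assoc[symmetric])
    finally show ?thesis .
  qed
qed

text \<open>Two linear conditions leave a nonzero solution in dimension at least 3: padded with zero
  rows, of which row 2 is one, they form a singular square matrix.\<close>

lemma ex_nonzero_orthogonal:
  fixes p q :: "'a::field vec"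
  assumes n: "n \<ge> 3" and p: "p \<in> carrier_vec n" and q: "q \<in> carrier_vec n"
  obtains x where "x \<in> carrier_vec n" "x \<noteq> 0\<^sub>v n" "p \<bullet> x = 0" "q \<bullet> x = 0"
proof -
  let ?A = "mat_of_rows n (p # q # replicate (n - 2) (0\<^sub>v n))"
  have A: "?A \<in> carrier_mat n n" using n by auto
  have r: "row ?A 0 = p" "row ?A 1 = q" "row ?A 2 = 0\<^sub>v n"
    using n p q by (auto simp: numeral_2_eq_2)
  have "det ?A = 0"
  proof -
    have "?A = mat\<^sub>r n n (\<lambda>i. if i = 2 then 0\<^sub>v n else row ?A i)"
      using A n r by (intro eq_rowI) auto
    moreover have "det (mat\<^sub>r n n (\<lambda>i. if i = 2 then 0\<^sub>v n else row ?A i)) = 0"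
      by (rule det_row_0) (use n A in auto)
    ultimately show ?thesis by simp
  qed
  then obtain x where x: "x \<in> carrier_vec n" "x \<noteq> 0\<^sub>v n" "?A *\<^sub>v x = 0\<^sub>v n"
    using det_0_iff_vec_prod_zero_field[OF A] by blast
  have "row ?A i \<bullet> x = 0" if "i < n" for i
  proof -
    have "row ?A i \<bullet> x = (?A *\<^sub>v x) $ i" using A that by simp
    thus ?thesis using x(3) that by simp
  qed
  from this[of 0] this[of 1] show ?thesis using that[of x] x r n by simp
qed

lemma transv_eqD:
  fixes u f v g :: "'a::comm_ring_1 vec"
  assumes "u \<in> carrier_vec n" "f \<in> carrier_vec n" "v \<in> carrier_vec n" "g \<in> carrier_vec n"
    and eq: "transv n u f = transv n v g"
  shows "outer_prod u f = outer_prod v g"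
proof (intro eq_matI)
  fix i j assume "i < dim_row (outer_prod v g)" "j < dim_col (outer_prod v g)"
  hence "i < n" "j < n" using assms by auto
  moreover have "transv n u f $$ (i, j) = transv n v g $$ (i, j)" by (simp only: eq)
  ultimately show "outer_prod u f $$ (i, j) = outer_prod v g $$ (i, j)"
    using assms by (simp add: transv_def)
qed (use assms in auto)

text \<open>The right side is a nonzero rank-one matrix, and such a matrix determines the line
  spanned by its columns.\<close>

lemma outer_prod_eq_imp_multiple:
  fixes u v :: "'a::field vec"
  assumes u: "u \<in> carrier_vec n" and v: "v \<in> carrier_vec n" "v \<noteq> 0\<^sub>v n"
    and f: "f \<in> carrier_vec n" "f \<noteq> 0\<^sub>v n" and g: "g \<in> carrier_vec n"
    and eq: "outer_prod u g = outer_prod v f"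
  shows "\<exists>c. u = c \<cdot>\<^sub>v v"
proof -
  have e: "u $ i * g $ j = v $ i * f $ j" if "i < n" "j < n" for i j
  proof -
    have "outer_prod u g $$ (i, j) = outer_prod v f $$ (i, j)" by (simp only: eq)
    thus ?thesis using that u v(1) f(1) g by simp
  qed
  obtain j where j: "j < n" "f $ j \<noteq> 0" using f by (metis carrier_vecD eq_vecI index_zero_vec)
  obtain i where i: "i < n" "v $ i \<noteq> 0" using v by (metis carrier_vecD eq_vecI index_zero_vec)
  have gj: "g $ j \<noteq> 0" using e[OF i(1) j(1)] i j by auto
  have "u = (f $ j / g $ j) \<cdot>\<^sub>v v"
  proof (intro eq_vecI)
    fix i assume "i < dim_vec ((f $ j / g $ j) \<cdot>\<^sub>v v)"
    hence "i < n" using v by simp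
    thus "u $ i = ((f $ j / g $ j) \<cdot>\<^sub>v v) $ i" using e[of i j] j v gj by (simp add: field_simps)
  qed (use u v in auto)
  thus ?thesis by blast
qed

text \<open>Unit vectors being eigenvectors makes \<open>A\<close> diagonal; the sum of two of them
  being one makes their diagonal entries agree.\<close>

lemma scalar_of_all_eigenvectors:
  fixes A :: "'a::field mat"
  assumes A: "A \<in> carrier_mat n n"
    and ev: "\<And>v. v \<in> carrier_vec n \<Longrightarrow> v \<noteq> 0\<^sub>v n \<Longrightarrow> \<exists>c. A *\<^sub>v v = c \<cdot>\<^sub>v v"
  obtains c where "A = c \<cdot>\<^sub>m 1\<^sub>m n"
proof -
  have ent: "A $$ (i, j) = (A *\<^sub>v unit_vec n j) $ i" if "i < n" "j < n" for i j
    using that A mult_unit_vec[OF A, of j] by simp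
  have off: "A $$ (i, j) = 0" if ij: "i < n" "j < n" "i \<noteq> j" for i j
  proof -
    obtain c where "A *\<^sub>v unit_vec n j = c \<cdot>\<^sub>v unit_vec n j" using ev[of "unit_vec n j"] ij by auto
    thus ?thesis using ent[OF ij(1,2)] ij by simp
  qed
  have diag: "A $$ (i, i) = A $$ (j, j)" if ij: "i < n" "j < n" "i \<noteq> j" for i j
  proof -
    let ?v = "unit_vec n i + unit_vec n j :: 'a vec"
    have "?v $ i = 1" using ij by simp
    hence "?v \<noteq> 0\<^sub>v n" using ij by (metis index_zero_vec(1) zero_neq_one)
    then obtain c where c: "A *\<^sub>v ?v = c \<cdot>\<^sub>v ?v" using ev[of ?v] by auto
    have "A *\<^sub>v ?v = A *\<^sub>v unit_vec n i + A *\<^sub>v unit_vec n j"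
      using A by (intro mult_add_distrib_mat_vec) auto
    hence *: "(A *\<^sub>v ?v) $ m = A $$ (m, i) + A $$ (m, j)" if "m < n" for m
      using that A ij by simp
    have "(c \<cdot>\<^sub>v ?v) $ i = A $$ (i, i)" "(c \<cdot>\<^sub>v ?v) $ j = A $$ (j, j)"
      using *[OF ij(1)] *[OF ij(2)] off ij unfolding c by auto
    thus ?thesis using ij by simp
  qed
  \<comment> \<open>For \<open>n = 0\<close> the entry is a default value, but both sides are then
    empty matrices.\<close>
  have "A = A $$ (0, 0) \<cdot>\<^sub>m 1\<^sub>m n"
  proof (intro eq_matI)
    fix i j assume "i < dim_row (A $$ (0, 0) \<cdot>\<^sub>m 1\<^sub>m n)" "j < dim_col (A $$ (0, 0) \<cdot>\<^sub>m 1\<^sub>m n)"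
    hence "i < n" "j < n" by auto
    thus "A $$ (i, j) = (A $$ (0, 0) \<cdot>\<^sub>m 1\<^sub>m n) $$ (i, j)"
      using off[of i j] diag[of i 0] by (cases "i = j"; cases "i = 0") auto
  qed (use A in auto)
  thus ?thesis by (rule that)
qed

text \<open>Each of two nested commutators doubles the number of conjugates, from 1 to 2 for
  \<open>B\<close> and from 2 to 4.\<close>

lemma transv_in_conj_ball:
  fixes A :: "'a::field mat"
  assumes n: "n \<ge> 3" and A: "A \<in> carrier (SL TYPE('a) n)"
    and v: "v \<in> carrier_vec n" "v \<noteq> 0\<^sub>v n" and nev: "\<And>c. A *\<^sub>v v \<noteq> c \<cdot>\<^sub>v v"
  obtains u f where "u \<in> carrier_vec n" "u \<noteq> 0\<^sub>v n" "f \<in> carrier_vec n" "f \<noteq> 0\<^sub>v n"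
    "f \<bullet> u = 0" "transv n u f \<in> conj_ball (SL TYPE('a) n) {A} 4"
proof -
  let ?G = "SL TYPE('a) n"
  interpret group ?G by (rule group_SL)
  have S: "{A} \<subseteq> carrier ?G" using A by simp
  note A' = SL_inverse[OF A]
  \<comment> \<open>There is only one condition here, so \<open>v\<close> is passed for
    both.\<close>
  obtain f where f: "f \<in> carrier_vec n" "f \<noteq> 0\<^sub>v n" "v \<bullet> f = 0"
    using ex_nonzero_orthogonal[OF n v(1) v(1)] by blast
  have fv: "f \<bullet> v = 0" using f v comm_scalar_prod by metis
  define E where "E = transv n v f"
  have E: "E \<in> carrier ?G" unfolding E_def using v f fv by (intro transv_SL)
  define w where "w = A *\<^sub>v v"
  define g where "g = (inv\<^bsub>?G\<^esub> A)\<^sup>T *\<^sub>v f"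
  have w: "w \<in> carrier_vec n" and g: "g \<in> carrier_vec n" using A' v f by (auto simp: w_def g_def)
  have AE: "A \<otimes>\<^bsub>?G\<^esub> E \<otimes>\<^bsub>?G\<^esub> inv\<^bsub>?G\<^esub> A = transv n w g" and gw: "g \<bullet> w = 0"
    using transv_conj[OF A v(1) f(1) fv] by (auto simp: E_def w_def g_def)
  have iE: "inv\<^bsub>?G\<^esub> E = transv n v (- f)"
    unfolding E_def using v(1) f(1) fv by (rule inv_transv)
  define B where "B = A \<otimes>\<^bsub>?G\<^esub> (E \<otimes>\<^bsub>?G\<^esub> inv\<^bsub>?G\<^esub> A \<otimes>\<^bsub>?G\<^esub> inv\<^bsub>?G\<^esub> E)"
  have A1: "A \<in> conj_ball ?G {A} 1" using S by (intro conj_ball_generator) auto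
  have B2: "B \<in> conj_ball ?G {A} 2"
    using conj_ball_commutator[OF S A1 E] by (simp add: B_def)
  have Bc: "B \<in> carrier ?G" using B2 conj_ball_closed[OF S] by blast
  note B' = SL_inverse[OF Bc]
  have BAE: "B = (A \<otimes>\<^bsub>?G\<^esub> E \<otimes>\<^bsub>?G\<^esub> inv\<^bsub>?G\<^esub> A) \<otimes>\<^bsub>?G\<^esub> inv\<^bsub>?G\<^esub> E"
    unfolding B_def using A E by (simp add: m_assoc)
  \<comment> \<open>If \<open>B\<close> were trivial, the transvections along
    \<open>A *\<^sub>v v\<close> and along \<open>v\<close> would coincide, and \<open>v\<close>
    would be an eigenvector.\<close>
  have Bn1: "B \<noteq> 1\<^sub>m n"
  proof
    assume "B = 1\<^sub>m n"
    hence "(A \<otimes>\<^bsub>?G\<^esub> E \<otimes>\<^bsub>?G\<^esub> inv\<^bsub>?G\<^esub> A) \<otimes>\<^bsub>?G\<^esub> inv\<^bsub>?G\<^esub> E = \<one>\<^bsub>?G\<^esub>"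
      using BAE by (simp add: one_SL)
    from inv_equality[OF this] have "A \<otimes>\<^bsub>?G\<^esub> E \<otimes>\<^bsub>?G\<^esub> inv\<^bsub>?G\<^esub> A = E" using A E by simp
    hence "transv n w g = transv n v f" by (simp only: AE) (simp only: E_def)
    hence "outer_prod w g = outer_prod v f" by (rule transv_eqD[OF w g v(1) f(1)])
    thus False using outer_prod_eq_imp_multiple[OF w v f(1,2) g] nev by (auto simp: w_def)
  qed
  \<comment> \<open>Both functionals vanish on \<open>x\<close>, so both transvections in
    \<open>B\<close> fix it.\<close>
  obtain x where x: "x \<in> carrier_vec n" "x \<noteq> 0\<^sub>v n" "f \<bullet> x = 0" "g \<bullet> x = 0"
    using ex_nonzero_orthogonal[OF n f(1) g] by blast
  have Bx: "B *\<^sub>v x = x"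
  proof -
    have "transv n v (- f) *\<^sub>v x = x"
      using v f x by (simp add: transv_mult_vec) (auto intro!: eq_vecI)
    moreover have "transv n w g *\<^sub>v x = x"
      using w g x by (simp add: transv_mult_vec) (auto intro!: eq_vecI)
    moreover have "B = transv n w g * transv n v (- f)"
      by (simp only: BAE AE iE) (simp only: mult_SL)
    moreover have "(transv n w g * transv n v (- f)) *\<^sub>v x = transv n w g *\<^sub>v (transv n v (- f) *\<^sub>v x)"
      by (rule assoc_mult_mat_vec) (use w g v f x in auto)
    ultimately show ?thesis by (simp only:)
  qed
  have BT: "B\<^sup>T \<in> carrier_mat n n" using B' by simp
  show ?thesis
  \<comment> \<open>As \<open>B\<close> fixes \<open>x\<close>, it conjugates a transvection along
    \<open>x\<close> into another along \<open>x\<close>. The split asks whether some such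
    transvection fails to commute with \<open>B\<close>; its commutator with \<open>B\<close> is
    then a nontrivial transvection along \<open>x\<close>.\<close>
  proof (cases "\<exists>h\<in>carrier_vec n. h \<bullet> x = 0 \<and> B\<^sup>T *\<^sub>v h \<noteq> h")
    case True
    then obtain h where h: "h \<in> carrier_vec n" "h \<bullet> x = 0" "B\<^sup>T *\<^sub>v h \<noteq> h" by blast
    define F where "F = transv n x h"
    have F: "F \<in> carrier ?G" unfolding F_def using x h by (intro transv_SL)
    define h' where "h' = (inv\<^bsub>?G\<^esub> B)\<^sup>T *\<^sub>v h"
    have h': "h' \<in> carrier_vec n" using B' h by (simp add: h'_def)
    have BF: "B \<otimes>\<^bsub>?G\<^esub> F \<otimes>\<^bsub>?G\<^esub> inv\<^bsub>?G\<^esub> B = transv n x h'" and h'x: "h' \<bullet> x = 0"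
      using transv_conj[OF Bc x(1) h(1,2)] Bx by (auto simp: F_def h'_def)
    have "B\<^sup>T *\<^sub>v h' = (B\<^sup>T * (inv\<^bsub>?G\<^esub> B)\<^sup>T) *\<^sub>v h"
      unfolding h'_def using BT B' h by (intro assoc_mult_mat_vec[symmetric]) auto
    also have "B\<^sup>T * (inv\<^bsub>?G\<^esub> B)\<^sup>T = 1\<^sub>m n"
      using transpose_mult[OF B'(2,1)] B'(4) by simp
    finally have "B\<^sup>T *\<^sub>v h' = h" using h by simp
    hence "h' \<noteq> h" using h(3) by blast
    have "B \<otimes>\<^bsub>?G\<^esub> (F \<otimes>\<^bsub>?G\<^esub> inv\<^bsub>?G\<^esub> B \<otimes>\<^bsub>?G\<^esub> inv\<^bsub>?G\<^esub> F) \<in> conj_ball ?G {A} 4"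
      using conj_ball_commutator[OF S B2 F] by simp
    also have "B \<otimes>\<^bsub>?G\<^esub> (F \<otimes>\<^bsub>?G\<^esub> inv\<^bsub>?G\<^esub> B \<otimes>\<^bsub>?G\<^esub> inv\<^bsub>?G\<^esub> F) = (B \<otimes>\<^bsub>?G\<^esub> F \<otimes>\<^bsub>?G\<^esub> inv\<^bsub>?G\<^esub> B) \<otimes>\<^bsub>?G\<^esub> inv\<^bsub>?G\<^esub> F"
      using Bc F by (simp add: m_assoc)
    also have "\<dots> = transv n x h' * transv n x (- h)"
      by (simp only: BF) (simp only: F_def inv_transv[OF x(1) h(1,2)] mult_SL)
    also have "\<dots> = transv n x (h' + - h)"
      using x(1) h' h(1) h'x by (intro transv_mult_transv) auto
    finally have T: "transv n x (h' + - h) \<in> conj_ball ?G {A} 4" .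
    have ne: "h' + - h \<noteq> 0\<^sub>v n"
    proof
      assume 0: "h' + - h = 0\<^sub>v n"
      have "h' $ i = h $ i" if "i < n" for i
        using arg_cong[OF 0, of "\<lambda>z. z $ i"] that h h' by simp
      hence "h' = h" using h h' by (intro eq_vecI) auto
      thus False using \<open>h' \<noteq> h\<close> by blast
    qed
    have "(h' + - h) \<bullet> x = 0"
      using x h h' h'x by (simp add: add_scalar_prod_distrib[of _ n])
    moreover have "h' + - h \<in> carrier_vec n" using h h' by simp
    ultimately show ?thesis using that[OF x(1,2)] T ne by blast
  next
    case False
    hence fix_: "B\<^sup>T *\<^sub>v h = h" if "h \<in> carrier_vec n" "h \<bullet> x = 0" for h using that by blast
    obtain i where i: "i < n" "x $ i \<noteq> 0" using x by (metis carrier_vecD eq_vecI index_zero_vec)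
    \<comment> \<open>Now \<open>B\<^sup>T\<close> is the identity on the hyperplane of functionals
      vanishing on \<open>x\<close>. Since \<open>z \<bullet> x = 1\<close>, \<open>z\<close> spans
      a complement, so \<open>B\<^sup>T\<close> is determined by \<open>h\<close>, its displacement
      of \<open>z\<close>, and \<open>B\<close> itself is a transvection along
      \<open>x\<close>.\<close>
    define z where "z = (1 / x $ i) \<cdot>\<^sub>v (unit_vec n i :: 'a vec)"
    have z: "z \<in> carrier_vec n" and zx: "z \<bullet> x = 1" using x i by (auto simp: z_def)
    define h where "h = B\<^sup>T *\<^sub>v z - z"
    have h: "h \<in> carrier_vec n" using BT z by (simp add: h_def)
    have "(B\<^sup>T *\<^sub>v z) \<bullet> x = z \<bullet> (B *\<^sub>v x)"
      by (rule transpose_vec_mult_scalar) (use B' x z in auto)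
    hence hx: "h \<bullet> x = 0"
      using BT z x zx Bx by (simp add: h_def minus_scalar_prod_distrib[of _ n])
    have "B\<^sup>T = transv n h x"
    proof (rule mat_eq_of_unit_vec)
      fix j assume j: "j < n"
      let ?e = "unit_vec n j :: 'a vec" and ?y = "unit_vec n j - x $ j \<cdot>\<^sub>v z"
      have y: "?y \<in> carrier_vec n" "?y \<bullet> x = 0"
        using z x zx j by (auto simp: minus_scalar_prod_distrib[of _ n])
      have "?e = ?y + x $ j \<cdot>\<^sub>v z" using z by (intro eq_vecI) auto
      hence "B\<^sup>T *\<^sub>v ?e = B\<^sup>T *\<^sub>v (?y + x $ j \<cdot>\<^sub>v z)" by simp
      also have "\<dots> = B\<^sup>T *\<^sub>v ?y + B\<^sup>T *\<^sub>v (x $ j \<cdot>\<^sub>v z)"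
        using BT y z by (intro mult_add_distrib_mat_vec) auto
      also have "\<dots> = ?y + x $ j \<cdot>\<^sub>v (B\<^sup>T *\<^sub>v z)"
        using fix_[OF y] mult_mat_vec[OF BT z] by simp
      also have "\<dots> = ?e + x $ j \<cdot>\<^sub>v h"
        unfolding h_def using z BT x by (intro eq_vecI) (auto simp: algebra_simps)
      also have "\<dots> = transv n h x *\<^sub>v ?e"
        using h x j by (simp add: transv_mult_vec)
      finally show "B\<^sup>T *\<^sub>v ?e = transv n h x *\<^sub>v ?e" .
    qed (use BT h x in auto)
    hence "B = (transv n h x)\<^sup>T" by (metis transpose_transpose)
    hence Bt: "B = transv n x h" using h x by (simp add: transpose_transv)
    hence "h \<noteq> 0\<^sub>v n" using Bn1 x transv_zero by auto
    moreover have "B \<in> conj_ball ?G {A} 4" by (rule subsetD[OF conj_ball_mono B2]) simp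
    ultimately show ?thesis using that[OF x(1,2) h _ hx] Bt by simp
  qed
qed

lemma SL_conj_ball:
  fixes A :: "'a::field mat"
  assumes n: "n \<ge> 3" and A: "A \<in> carrier (SL TYPE('a) n)"
    and v: "v \<in> carrier_vec n" "v \<noteq> 0\<^sub>v n" and nev: "\<And>c. A *\<^sub>v v \<noteq> c \<cdot>\<^sub>v v"
  shows "carrier (SL TYPE('a) n) \<subseteq> conj_ball (SL TYPE('a) n) {A} (12 * (n - 1))"
proof
  let ?G = "SL TYPE('a) n"
  interpret group ?G by (rule group_SL)
  have S: "{A} \<subseteq> carrier ?G" using A by simp
  obtain u f where "u \<in> carrier_vec n" "u \<noteq> 0\<^sub>v n" "f \<in> carrier_vec n" "f \<noteq> 0\<^sub>v n"
    "f \<bullet> u = 0" "transv n u f \<in> conj_ball ?G {A} 4"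
    using transv_in_conj_ball[OF n A v nev] by blast
  hence T: "transvs n \<subseteq> conj_ball ?G {A} 4"
    by (rule transvs_subset_conj_ball[OF n S])
  fix X assume X: "X \<in> carrier ?G"
  have n': "Suc (0 + (n - 1)) = n" using n by simp
  have "X \<in> conj_ball ?G (transvs n) (2 * (n - 1) + 1)"
    using SL_transv_generation[of X 0 "n - 1", unfolded n'] X by simp
  hence "X \<in> conj_ball ?G {A} (4 * (2 * (n - 1) + 1))"
    using conj_ball_trans[OF S T] by blast
  \<comment> \<open>The radius is \<open>8 * (n - 1) + 4\<close>, and 4 is at most
    \<open>4 * (n - 1)\<close>.\<close>
  thus "X \<in> conj_ball ?G {A} (12 * (n - 1))"
    by (rule subsetD[OF conj_ball_mono, rotated]) (use n in simp)
qed

lemma scalar_commute: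
  fixes A :: "'a::field mat"
  assumes A: "A \<in> carrier_mat n n"
  shows "(c \<cdot>\<^sub>m 1\<^sub>m n) * A = A * (c \<cdot>\<^sub>m 1\<^sub>m n)"
  using mult_smult_assoc_mat[OF one_carrier_mat A, of c] mult_smult_distrib[OF A one_carrier_mat, of c] A
  by simp

text \<open>If every nonzero vector were an eigenvector, \<open>A\<close> would be scalar and so
  commute with everything.\<close>

lemma SL_noncentral:
  fixes A :: "'a::field mat"
  assumes A: "A \<in> carrier (SL TYPE('a) n)" "A \<notin> group_center (SL TYPE('a) n)"
  obtains v where "v \<in> carrier_vec n" "v \<noteq> 0\<^sub>v n" "\<And>c. A *\<^sub>v v \<noteq> c \<cdot>\<^sub>v v"
proof -
  have Ac: "A \<in> carrier_mat n n" using A by (simp add: carrier_SL)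
  have "\<not> (\<forall>v\<in>carrier_vec n. v \<noteq> 0\<^sub>v n \<longrightarrow> (\<exists>c. A *\<^sub>v v = c \<cdot>\<^sub>v v))"
  proof
    assume "\<forall>v\<in>carrier_vec n. v \<noteq> 0\<^sub>v n \<longrightarrow> (\<exists>c. A *\<^sub>v v = c \<cdot>\<^sub>v v)"
    then obtain c where "A = c \<cdot>\<^sub>m 1\<^sub>m n" using scalar_of_all_eigenvectors[OF Ac] by blast
    hence "A \<in> group_center (SL TYPE('a) n)"
      using A(1) scalar_commute by (auto simp: group_center_def mult_SL carrier_SL)
    thus False using A(2) by blast
  qed
  thus ?thesis using that by blast
qed

text \<open>Conjugation by a central element fixes every transvection along \<open>v\<close>, hence
  preserves the line of \<open>v\<close>, for each \<open>v\<close>. This bounds the order of the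
  center.\<close>

lemma SL_central_scalar:
  fixes A :: "'a::field mat"
  assumes n: "n \<ge> 3" and A: "A \<in> group_center (SL TYPE('a) n)"
  obtains c where "A = c \<cdot>\<^sub>m 1\<^sub>m n"
proof -
  let ?G = "SL TYPE('a) n"
  interpret group ?G by (rule group_SL)
  have As: "A \<in> carrier ?G" and comm: "\<And>B. B \<in> carrier ?G \<Longrightarrow> A \<otimes>\<^bsub>?G\<^esub> B = B \<otimes>\<^bsub>?G\<^esub> A"
    using A by (auto simp: group_center_def)
  note A' = SL_inverse[OF As]
  have "\<exists>c. A *\<^sub>v v = c \<cdot>\<^sub>v v" if v: "v \<in> carrier_vec n" "v \<noteq> 0\<^sub>v n" for v
  proof -
    obtain f where f: "f \<in> carrier_vec n" "f \<noteq> 0\<^sub>v n" "v \<bullet> f = 0"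
      using ex_nonzero_orthogonal[OF n v(1) v(1)] by blast
    have fv: "f \<bullet> v = 0" using f v comm_scalar_prod by metis
    have E: "transv n v f \<in> carrier ?G" using v f fv by (intro transv_SL)
    have "transv n (A *\<^sub>v v) ((inv\<^bsub>?G\<^esub> A)\<^sup>T *\<^sub>v f) = A \<otimes>\<^bsub>?G\<^esub> transv n v f \<otimes>\<^bsub>?G\<^esub> inv\<^bsub>?G\<^esub> A"
      using transv_conj(1)[OF As v(1) f(1) fv] by simp
    also have "\<dots> = transv n v f" using comm[OF E] As E by (simp add: m_assoc)
    finally have "outer_prod (A *\<^sub>v v) ((inv\<^bsub>?G\<^esub> A)\<^sup>T *\<^sub>v f) = outer_prod v f"
      by (rule transv_eqD[rotated 4]) (use A' v f in auto)
    thus ?thesis using A' v f by (intro outer_prod_eq_imp_multiple[OF _ v f(1,2)]) auto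
  qed
  thus ?thesis using scalar_of_all_eigenvectors[OF A'(1)] that by blast
qed

section \<open>The order of the special linear group\<close>

text \<open>Only the first \<open>k\<close> coordinates are free. The uses are an empty tail for all
  vectors, a zero tail for excluded columns, and a single final entry 1 for the last column.\<close>

lemma card_vec_prescribed_tail:
  fixes c :: "nat \<Rightarrow> 'a::finite"
  assumes k: "k \<le> n"
  shows "card {w \<in> carrier_vec n. \<forall>i. k \<le> i \<longrightarrow> i < n \<longrightarrow> w $ i = c i} = CARD('a) ^ k"
proof -
  let ?L = "{xs :: 'a list. set xs \<subseteq> UNIV \<and> length xs = k}"
  let ?f = "\<lambda>xs. vec n (\<lambda>i. if i < k then xs ! i else c i)"
  have "inj_on ?f ?L"
  proof (rule inj_onI)
    fix xs ys assume xy: "xs \<in> ?L" "ys \<in> ?L" and eq: "?f xs = ?f ys"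
    show "xs = ys"
    proof (rule nth_equalityI)
      fix i assume i: "i < length xs"
      have "?f xs $ i = ?f ys $ i" by (simp only: eq)
      thus "xs ! i = ys ! i" using i xy k by simp
    qed (use xy in simp)
  qed
  moreover have "?f ` ?L = {w \<in> carrier_vec n. \<forall>i. k \<le> i \<longrightarrow> i < n \<longrightarrow> w $ i = c i}"
  proof (intro equalityI subsetI)
    fix w assume w: "w \<in> {w \<in> carrier_vec n. \<forall>i. k \<le> i \<longrightarrow> i < n \<longrightarrow> w $ i = c i}"
    hence "w = ?f (map (($) w) [0..<k])" by (intro eq_vecI) auto
    thus "w \<in> ?f ` ?L" by (rule image_eqI) simp
  qed auto
  ultimately show ?thesis
    using card_image[of ?f ?L] card_lists_length_eq[of "UNIV :: 'a set" k] by simp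
qed

lemma card_carrier_vec: "card (carrier_vec n :: 'a::finite vec set) = CARD('a) ^ n"
proof -
  have "(carrier_vec n :: 'a vec set) = {w \<in> carrier_vec n. \<forall>i. n \<le> i \<longrightarrow> i < n \<longrightarrow> w $ i = undefined i}"
    by auto
  thus ?thesis using card_vec_prescribed_tail[of n n "undefined :: nat \<Rightarrow> 'a"] by simp
qed

lemma finite_carrier_vec: "finite (carrier_vec n :: 'a::finite vec set)"
  by (rule card_ge_0_finite) (simp add: card_carrier_vec)

lemma finite_carrier_mat: "finite (carrier_mat m n :: 'a::finite mat set)"
proof (rule finite_subset)
  show "carrier_mat m n \<subseteq> mat_of_cols m ` {vs :: 'a vec list. set vs \<subseteq> carrier_vec m \<and> length vs = n}"
  proof
    fix A :: "'a mat" assume A: "A \<in> carrier_mat m n"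
    hence "A = mat_of_cols m (cols A)" by auto
    thus "A \<in> mat_of_cols m ` {vs. set vs \<subseteq> carrier_vec m \<and> length vs = n}"
      by (rule image_eqI) (use A cols_dim[of A] in auto)
  qed
  show "finite (mat_of_cols m ` {vs :: 'a vec list. set vs \<subseteq> carrier_vec m \<and> length vs = n})"
    by (intro finite_imageI finite_lists_length_eq finite_carrier_vec)
qed

lemma finite_SL: "finite (carrier (SL TYPE('a::{field,finite}) n))"
  by (rule finite_subset[OF _ finite_carrier_mat[of n n]]) (auto simp: carrier_SL)

text \<open>The pointwise stabilizer of the first \<open>k\<close> unit vectors. The group order is
  bounded along this chain, which starts with the whole group at \<open>k = 0\<close>.\<close>

definition SL_fix :: "nat \<Rightarrow> nat \<Rightarrow> 'a::field mat set" where
  "SL_fix n k = {A \<in> carrier (SL TYPE('a) n). \<forall>j<k. A *\<^sub>v unit_vec n j = unit_vec n j}"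

text \<open>Each \<open>w\<close> in \<open>W\<close> is column \<open>k\<close> of some element of
  \<open>SL_fix n k\<close>. With \<open>M w\<close> carrying \<open>w\<close> to
  \<open>unit_vec n k\<close>, the product of \<open>inv (M w)\<close> and \<open>B\<close> has
  column \<open>k\<close> equal to \<open>w\<close>; this recovers \<open>w\<close>, and then
  \<open>B\<close> by cancellation, so pairs embed into \<open>SL_fix n k\<close>.\<close>

lemma card_SL_fix_Suc:
  fixes W :: "'a::{field,finite} vec set"
  assumes k: "k < n" and W: "W \<subseteq> carrier_vec n"
    and ne: "\<And>w. w \<in> W \<Longrightarrow> \<exists>i. k \<le> i \<and> i < n \<and> w $ i \<noteq> 0"
    and last: "\<And>w. w \<in> W \<Longrightarrow> Suc k < n \<or> w $ k = 1"
  shows "card W * card (SL_fix n (Suc k) :: 'a mat set) \<le> card (SL_fix n k :: 'a mat set)"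
proof -
  let ?G = "SL TYPE('a) n"
  interpret group ?G by (rule group_SL)
  have "\<exists>M. M \<in> carrier ?G \<and> M *\<^sub>v w = unit_vec n k \<and> (\<forall>j<k. M *\<^sub>v unit_vec n j = unit_vec n j)"
    if w: "w \<in> W" for w
  proof -
    obtain i where i: "k \<le> i" "i < n" "w $ i \<noteq> 0" using ne[OF w] by blast
    have "w \<in> carrier_vec n" using w W by blast
    from clear_column[OF this k i last[OF w]] show ?thesis
      using conj_ball_closed[OF transvs_subset] by blast
  qed
  then obtain M where M: "\<And>w. w \<in> W \<Longrightarrow> M w \<in> carrier ?G" "\<And>w. w \<in> W \<Longrightarrow> M w *\<^sub>v w = unit_vec n k"
    "\<And>w j. w \<in> W \<Longrightarrow> j < k \<Longrightarrow> M w *\<^sub>v unit_vec n j = unit_vec n j"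
    by metis
  let ?f = "\<lambda>(w, B). inv\<^bsub>?G\<^esub> (M w) * B"
  have inv_mult: "inv\<^bsub>?G\<^esub> (M w) *\<^sub>v y = x"
    if "w \<in> W" "x \<in> carrier_vec n" "M w *\<^sub>v x = y" for w x y
  proof -
    note * = SL_inverse[OF M(1)[OF that(1)]]
    have "inv\<^bsub>?G\<^esub> (M w) *\<^sub>v y = (inv\<^bsub>?G\<^esub> (M w) * M w) *\<^sub>v x"
      unfolding that(3)[symmetric] by (rule assoc_mult_mat_vec[OF *(2,1) that(2), symmetric])
    thus ?thesis using * that by simp
  qed
  have f_vec: "(inv\<^bsub>?G\<^esub> (M w) * B) *\<^sub>v unit_vec n j = inv\<^bsub>?G\<^esub> (M w) *\<^sub>v unit_vec n j"
    if "w \<in> W" "B \<in> SL_fix n (Suc k)" "j \<le> k" for w B j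
  proof -
    have "(inv\<^bsub>?G\<^esub> (M w) * B) *\<^sub>v unit_vec n j = inv\<^bsub>?G\<^esub> (M w) *\<^sub>v (B *\<^sub>v unit_vec n j)"
      using SL_inverse[OF M(1)[OF that(1)]] that
      by (intro assoc_mult_mat_vec) (auto simp: SL_fix_def carrier_SL)
    thus ?thesis using that by (simp add: SL_fix_def)
  qed
  have "inj_on ?f (W \<times> SL_fix n (Suc k))"
  proof (rule inj_onI, clarify)
    fix w w' and B B' :: "'a mat"
    assume w: "w \<in> W" "w' \<in> W" and B: "B \<in> SL_fix n (Suc k)" "B' \<in> SL_fix n (Suc k)"
      and eq: "inv\<^bsub>?G\<^esub> (M w) * B = inv\<^bsub>?G\<^esub> (M w') * B'"
    have "w = inv\<^bsub>?G\<^esub> (M w) *\<^sub>v unit_vec n k"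
      using inv_mult[OF w(1) _ M(2)[OF w(1)]] w W by auto
    also have "\<dots> = inv\<^bsub>?G\<^esub> (M w') *\<^sub>v unit_vec n k"
      using f_vec[OF w(1) B(1), of k] f_vec[OF w(2) B(2), of k] eq by simp
    also have "\<dots> = w'"
      using inv_mult[OF w(2) _ M(2)[OF w(2)]] w W by auto
    finally have ww: "w = w'" .
    have "inv\<^bsub>?G\<^esub> (M w) \<otimes>\<^bsub>?G\<^esub> B = inv\<^bsub>?G\<^esub> (M w) \<otimes>\<^bsub>?G\<^esub> B'"
      using eq ww by (simp add: mult_SL)
    hence "B = B'" using B M(1)[OF w(1)] by (simp add: SL_fix_def)
    with ww show "w = w' \<and> B = B'" by simp
  qed
  moreover have "?f ` (W \<times> SL_fix n (Suc k)) \<subseteq> SL_fix n k"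
  proof clarify
    fix w and B :: "'a mat" assume w: "w \<in> W" and B: "B \<in> SL_fix n (Suc k)"
    have "B \<in> carrier ?G" using B by (simp add: SL_fix_def)
    hence "inv\<^bsub>?G\<^esub> (M w) * B \<in> carrier ?G"
      using m_closed[of "inv\<^bsub>?G\<^esub> (M w)" B] M(1)[OF w] by (simp add: mult_SL)
    moreover have "(inv\<^bsub>?G\<^esub> (M w) * B) *\<^sub>v unit_vec n j = unit_vec n j" if "j < k" for j
      using f_vec[OF w B, of j] inv_mult[OF w _ M(3)[OF w that]] that by simp
    ultimately show "inv\<^bsub>?G\<^esub> (M w) * B \<in> SL_fix n k" by (simp add: SL_fix_def)
  qed
  moreover have "finite (SL_fix n k :: 'a mat set)"
    by (rule finite_subset[OF _ finite_SL]) (auto simp: SL_fix_def)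
  ultimately have "card (W \<times> (SL_fix n (Suc k) :: 'a mat set)) \<le> card (SL_fix n k :: 'a mat set)"
    by (rule card_inj_on_le)
  thus ?thesis by (simp add: card_cartesian_product)
qed

(* The factor 1/2 + 1/2^(n-k) is an inductive lower bound for the product of the
   1 - q^(-i) over 2 \<le> i \<le> n - k. *)
lemma card_SL_fix_ge:
  fixes q :: nat
  assumes n: "n = Suc (k + d)" and q: "q = CARD('a::{field,finite})"
  shows "real q ^ (n * Suc d - 1) * (1 / 2 + 1 / 2 ^ Suc d) \<le> card (SL_fix n k :: 'a mat set)"
  using n
proof (induction d arbitrary: k)
  case 0
  \<comment> \<open>Here \<open>n = Suc k\<close>, so only entry \<open>k\<close> is prescribed,
    namely as 1, and \<open>q ^ k\<close> columns are counted. The factor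
    \<open>1 / 2 + 1 / 2 ^ Suc d\<close> is 1 for \<open>d = 0\<close>.\<close>
  let ?W = "{w \<in> carrier_vec n. \<forall>i. k \<le> i \<longrightarrow> i < n \<longrightarrow> w $ i = (\<lambda>_. 1 :: 'a) i}"
  have k: "k < n" using 0 by simp
  have "card ?W * card (SL_fix n (Suc k) :: 'a mat set) \<le> card (SL_fix n k :: 'a mat set)"
    by (rule card_SL_fix_Suc[OF k]) (use k in \<open>auto intro!: exI[of _ k]\<close>)
  moreover have "card ?W = q ^ k" unfolding q using k by (intro card_vec_prescribed_tail) simp
  moreover have "card (SL_fix n (Suc k) :: 'a mat set) \<ge> 1"
  proof -
    have "1\<^sub>m n \<in> (SL_fix n (Suc k) :: 'a mat set)" by (simp add: SL_fix_def carrier_SL)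
    moreover have "finite (SL_fix n (Suc k) :: 'a mat set)"
      by (rule finite_subset[OF _ finite_SL]) (auto simp: SL_fix_def)
    ultimately show ?thesis by (metis One_nat_def Suc_leI card_gt_0_iff empty_iff)
  qed
  ultimately have "q ^ k \<le> card (SL_fix n k :: 'a mat set)"
    by (metis mult.right_neutral mult_le_mono2 order_trans)
  hence "real (q ^ k) \<le> real (card (SL_fix n k :: 'a mat set))" by (simp only: of_nat_le_iff)
  thus ?case using 0 by simp
next
  case (Suc d)
  let ?i = "Suc (Suc d)"
  \<comment> \<open>The columns to be avoided: the span of the unit vectors already fixed.\<close>
  let ?Z = "{w \<in> carrier_vec n. \<forall>i. k \<le> i \<longrightarrow> i < n \<longrightarrow> w $ i = (\<lambda>_. 0 :: 'a) i}"
  let ?W = "carrier_vec n - ?Z"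
  have k: "k < n" and nk: "n = k + ?i" using Suc.prems by simp_all
  have "card {0, 1 :: 'a} \<le> CARD('a)" by (intro card_mono) auto
  hence q2: "q \<ge> 2" unfolding q by simp
  have "card ?Z = q ^ k" unfolding q using k by (intro card_vec_prescribed_tail) simp
  moreover have "card ?W = card (carrier_vec n :: 'a vec set) - card ?Z"
    by (intro card_Diff_subset finite_subset[OF _ finite_carrier_vec[of n]]) auto
  ultimately have W: "card ?W = q ^ n - q ^ k" by (simp add: card_carrier_vec q)
  have "q ^ k \<le> q ^ n" using k q2 by (intro power_increasing) auto
  hence "real (card ?W) = real q ^ n - real q ^ k" by (simp add: W)
  also have "\<dots> = real q ^ n * (1 - 1 / real q ^ ?i)"
    using q2 by (simp add: nk power_add field_simps)
  also have "\<dots> \<ge> real q ^ n * (1 - 1 / 2 ^ ?i)"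
    using q2 by (intro mult_left_mono diff_left_mono divide_left_mono power_mono) auto
  finally have W': "real q ^ n * (1 - 1 / 2 ^ ?i) \<le> real (card ?W)" .
  \<comment> \<open>With \<open>t = 1 / 2 ^ d\<close> the right side exceeds the left by
    \<open>(t - t * t) / 8\<close>.\<close>
  have "1 / 2 + 1 / 2 ^ ?i \<le> (1 - 1 / 2 ^ ?i) * (1 / 2 + 1 / 2 ^ Suc d :: real)"
  proof -
    define t :: real where "t = 1 / 2 ^ d"
    have t: "0 \<le> t" "t \<le> 1" by (simp_all add: t_def)
    have "t * t \<le> t * 1" using t by (intro mult_left_mono) auto
    moreover have e: "1 / 2 ^ ?i = t / 4" "1 / 2 ^ Suc d = t / 2" by (simp_all add: t_def)
    ultimately show ?thesis unfolding e by (simp add: algebra_simps)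
  qed
  hence "real q ^ (n + (n * Suc d - 1)) * (1 / 2 + 1 / 2 ^ ?i) \<le>
      real q ^ (n + (n * Suc d - 1)) * ((1 - 1 / 2 ^ ?i) * (1 / 2 + 1 / 2 ^ Suc d))"
    by (rule mult_left_mono) simp
  also have "real q ^ (n + (n * Suc d - 1)) * ((1 - 1 / 2 ^ ?i) * (1 / 2 + 1 / 2 ^ Suc d)) =
      (real q ^ n * (1 - 1 / 2 ^ ?i)) * (real q ^ (n * Suc d - 1) * (1 / 2 + 1 / 2 ^ Suc d))"
    by (simp only: power_add mult_ac)
  also have "\<dots> \<le> real (card ?W) * real (card (SL_fix n (Suc k) :: 'a mat set))"
    by (rule mult_mono[OF W' Suc.IH]) (use Suc.prems in auto)
  also have "\<dots> \<le> real (card (SL_fix n k :: 'a mat set))"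
  proof -
    have "card ?W * card (SL_fix n (Suc k) :: 'a mat set) \<le> card (SL_fix n k :: 'a mat set)"
      by (rule card_SL_fix_Suc[OF k]) (use nk in auto)
    thus ?thesis by (simp only: of_nat_mult[symmetric] of_nat_le_iff)
  qed
  also have "n + (n * Suc d - 1) = n * ?i - 1" using Suc.prems by simp
  finally show ?case .
qed

lemma card_SL_ge:
  assumes n: "n \<ge> 1"
  shows "CARD('a::{field,finite}) ^ (n * n - 1) \<le> 2 * card (carrier (SL TYPE('a) n))"
proof -
  have "n = Suc (0 + (n - 1))" using n by simp
  from card_SL_fix_ge[OF this refl, where 'a = 'a]
  have "real CARD('a) ^ (n * n - 1) * (1 / 2 + 1 / 2 ^ n) \<le> card (carrier (SL TYPE('a) n))"
    using n by (simp add: SL_fix_def)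
  moreover have "real CARD('a) ^ (n * n - 1) * (1 / 2) \<le> real CARD('a) ^ (n * n - 1) * (1 / 2 + 1 / 2 ^ n)"
    by (intro mult_left_mono) auto
  ultimately have "real CARD('a) ^ (n * n - 1) \<le> 2 * real (card (carrier (SL TYPE('a) n)))"
    by linarith
  hence "real (CARD('a) ^ (n * n - 1)) \<le> real (2 * card (carrier (SL TYPE('a) n)))"
    by (simp only: of_nat_power of_nat_mult of_nat_numeral)
  thus ?thesis by (simp only: of_nat_le_iff)
qed

section \<open>The projective special linear group\<close>

lemma (in group) group_center_normal: "group_center G \<lhd> G"
proof -
  have c: "x \<otimes> z \<otimes> inv x = z" if "z \<in> group_center G" "x \<in> carrier G" for x z
  proof -
    have z: "z \<in> carrier G" and "z \<otimes> x = x \<otimes> z" using that by (auto simp: group_center_def)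
    hence "x \<otimes> z \<otimes> inv x = z \<otimes> x \<otimes> inv x" by simp
    also have "\<dots> = z" using z that by (simp add: m_assoc)
    finally show ?thesis .
  qed
  have "subgroup (group_center G) G"
  proof (rule subgroupI)
    show "group_center G \<subseteq> carrier G" by (auto simp: group_center_def)
    have "\<one> \<in> group_center G" by (simp add: group_center_def)
    thus "group_center G \<noteq> {}" by blast
  next
    fix z assume z: "z \<in> group_center G"
    hence zc: "z \<in> carrier G" by (simp add: group_center_def)
    have "inv z \<otimes> x = x \<otimes> inv z" if x: "x \<in> carrier G" for x
    proof -
      have "inv z \<otimes> x = inv (inv x \<otimes> z)" using x zc by (simp add: inv_mult_group)
      also have "inv x \<otimes> z = z \<otimes> inv x"
        using z x unfolding group_center_def by simp
      also have "inv (z \<otimes> inv x) = x \<otimes> inv z" using x zc by (simp add: inv_mult_group)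
      finally show ?thesis .
    qed
    thus "inv z \<in> group_center G" using zc by (simp add: group_center_def)
  next
    fix y z assume yz: "y \<in> group_center G" "z \<in> group_center G"
    hence c: "y \<in> carrier G" "z \<in> carrier G" by (auto simp: group_center_def)
    have "y \<otimes> z \<otimes> x = x \<otimes> (y \<otimes> z)" if x: "x \<in> carrier G" for x
    proof -
      have "y \<otimes> z \<otimes> x = y \<otimes> (z \<otimes> x)" using c x by (simp add: m_assoc)
      also have "z \<otimes> x = x \<otimes> z" using yz x by (simp add: group_center_def)
      also have "y \<otimes> (x \<otimes> z) = (y \<otimes> x) \<otimes> z" using c x by (simp add: m_assoc)
      also have "y \<otimes> x = x \<otimes> y" using yz x by (simp add: group_center_def)
      finally show ?thesis using c x by (simp add: m_assoc)
    qed
    thus "y \<otimes> z \<in> group_center G" using c by (simp add: group_center_def)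
  qed
  thus ?thesis by (simp add: normal_inv_iff c)
qed

lemma (in group_hom) conj_ball_hom:
  "S \<subseteq> carrier G \<Longrightarrow> g \<in> conj_ball G S m \<Longrightarrow> h g \<in> conj_ball H (h ` S) m"
  using is_conj_product_hom by (auto simp: conj_ball_def)

lemma group_PSL: "group (PSL F n)"
  unfolding PSL_def
  by (rule normal.factorgroup_is_group[OF group.group_center_normal[OF group_SL]])

text \<open>A nontrivial \<open>x\<close> lifts to a non-central matrix, to which the bound in the
  special linear group applies; the projection carries that bound down.\<close>

lemma PSL_conj_ball:
  fixes x g :: "'a::field mat set"
  assumes n: "n \<ge> 3" and x: "x \<in> carrier (PSL TYPE('a) n)" "x \<noteq> \<one>\<^bsub>PSL TYPE('a) n\<^esub>"
    and g: "g \<in> carrier (PSL TYPE('a) n)"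
  shows "g \<in> conj_ball (PSL TYPE('a) n) {x} (12 * (n - 1))"
proof -
  let ?G = "SL TYPE('a) n"
  let ?Z = "group_center ?G"
  interpret SL: group ?G by (rule group_SL)
  interpret Z: normal ?Z ?G by (rule SL.group_center_normal)
  let ?p = "\<lambda>A. ?Z #>\<^bsub>?G\<^esub> A"
  interpret p: group_hom ?G "?G Mod ?Z" ?p
    by (intro group_hom.intro group_hom_axioms.intro SL.group_axioms Z.factorgroup_is_group Z.r_coset_hom_Mod)
  obtain A where A: "A \<in> carrier ?G" "x = ?p A" using x(1) by (auto simp: PSL_def FactGroup_def RCOSETS_def)
  obtain B where B: "B \<in> carrier ?G" "g = ?p B" using g by (auto simp: PSL_def FactGroup_def RCOSETS_def)
  have "A \<notin> ?Z"
  proof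
    assume "A \<in> ?Z"
    hence "x = ?Z" unfolding A(2) by (rule SL.coset_join2[OF A(1) Z.subgroup_axioms])
    thus False using x(2) by (simp add: PSL_def FactGroup_def)
  qed
  from SL_noncentral[OF A(1) this] obtain v where
    "v \<in> carrier_vec n" "v \<noteq> 0\<^sub>v n" "\<And>c. A *\<^sub>v v \<noteq> c \<cdot>\<^sub>v v" by blast
  from SL_conj_ball[OF n A(1) this] B(1) have "B \<in> conj_ball ?G {A} (12 * (n - 1))" by blast
  from p.conj_ball_hom[OF _ this] show ?thesis
    using A B by (simp add: PSL_def)
qed

lemma finite_PSL: "finite (carrier (PSL TYPE('a::{field,finite}) n))"
  using finite_SL[where 'a = 'a, of n] by (simp add: PSL_def FactGroup_def RCOSETS_def)

text \<open>By Lagrange the order is that of the special linear group divided by that of its center.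
  The center consists of scalars, so at most \<open>CARD('a)\<close> elements, which lowers the
  exponent by one.\<close>

lemma card_PSL_ge:
  assumes n: "n \<ge> 3"
  shows "CARD('a::{field,finite}) ^ (n * n - 2) \<le> 2 * card (carrier (PSL TYPE('a) n))"
proof -
  let ?G = "SL TYPE('a) n"
  let ?Z = "group_center ?G"
  interpret SL: group ?G by (rule group_SL)
  have sub: "subgroup ?Z ?G" by (rule normal_imp_subgroup[OF SL.group_center_normal])
  have "?Z \<subseteq> range (\<lambda>c. c \<cdot>\<^sub>m 1\<^sub>m n)"
    using SL_central_scalar[OF n] by blast
  hence "card ?Z \<le> CARD('a)" by (rule surj_card_le[rotated]) simp
  hence Z: "card (carrier (PSL TYPE('a) n)) * card ?Z \<le> card (carrier (PSL TYPE('a) n)) * CARD('a)"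
    by (rule mult_left_mono) simp
  have "card (carrier (PSL TYPE('a) n)) * card ?Z = card (carrier ?G)"
    using SL.lagrange[OF sub] by (simp add: PSL_def FactGroup_def Coset.order_def)
  moreover have "CARD('a) ^ (n * n - 1) \<le> 2 * card (carrier ?G)"
    using n by (intro card_SL_ge) simp
  ultimately have "CARD('a) ^ (n * n - 1) \<le> (2 * card (carrier (PSL TYPE('a) n))) * CARD('a)"
    using Z by linarith
  \<comment> \<open>Subtraction is truncated, so \<open>n * n \<ge> 2\<close> has to be
    secured.\<close>
  moreover have "n * n - 1 = Suc (n * n - 2)"
    using mult_le_mono[OF n n] by simp
  ultimately have "CARD('a) ^ (n * n - 2) * CARD('a) \<le> (2 * card (carrier (PSL TYPE('a) n))) * CARD('a)"
    by (simp only: power_Suc2)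
  thus ?thesis by simp
qed

section \<open>The diameter bound and the logarithmic estimates\<close>

theorem proposition1p7:
  fixes n q :: nat and G :: "'a::{field,finite} mat set monoid"
  assumes n: "n \<ge> 3"
    and q: "primepow q"
    and field_card: "CARD('a) = q"
    and G: "G = PSL TYPE('a) n"
  shows "Delta G \<le> enat (12 * (n - 1)) \<and>
    (\<forall>S. nontrivial_conjugacy_class G S \<longrightarrow>
       ereal (log 2 (real (card S)))
         > ereal (log 2 (real (card (carrier G)))) / ereal_of_enat (Delta G) - 2 \<and>
       ereal (log 2 (real (card (carrier G)))) / ereal_of_enat (Delta G) - 2
         \<ge> ereal ((real n + 1) * (log 2 (real q) / 12)
                   - (log 2 (real q) + 2) / (12 * (real n - 1)) - 2))"
proof -
  interpret group G unfolding G by (rule group_PSL)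
  have ball: "g \<in> conj_ball G {x} (12 * (n - 1))"
    if "x \<in> carrier G" "x \<noteq> \<one>\<^bsub>G\<^esub>" "g \<in> carrier G" for x g
    using PSL_conj_ball[OF n] that unfolding G by blast
  have Delta: "Delta G \<le> enat (12 * (n - 1))" using ball by (rule Delta_le)
  then obtain D where D: "Delta G = enat D" "D \<le> 12 * (n - 1)"
    by (cases "Delta G") auto
  have fin: "finite (carrier G)" unfolding G by (rule finite_PSL)
  define a where "a = log 2 (real (card (carrier G)))"
  define l where "l = log 2 (real q)"
  have "q > 1" using q by (rule primepow_gt_Suc_0[unfolded One_nat_def[symmetric]])
  hence l: "l \<ge> 1" by (simp add: l_def le_log_iff)
  \<comment> \<open>The 1 subtracted is the logarithm of the factor 2 in
    \<open>card_PSL_ge\<close>.\<close>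
  have "real (n * n - 2) * l - 1 \<le> a"
  proof -
    have "real (q ^ (n * n - 2)) \<le> real (2 * card (carrier G))"
      using card_PSL_ge[OF n, where 'a = 'a] unfolding G field_card by (simp only: of_nat_le_iff)
    hence "log 2 (real (q ^ (n * n - 2))) \<le> log 2 (real (2 * card (carrier G)))"
      using \<open>q > 1\<close> by (intro log_mono) auto
    moreover have "card (carrier G) > 0" using fin card_gt_0_iff by blast
    ultimately show ?thesis using \<open>q > 1\<close> by (simp add: log_nat_power log_mult a_def l_def)
  qed
  moreover have "real (n * n - 2) = real n * real n - 2"
    using mult_le_mono[OF n n] by simp
  ultimately have a: "(real n * real n - 2) * l - 1 \<le> a" by simp
  \<comment> \<open>This leads to \<open>a \<ge> 0\<close>, which is what allows \<open>D\<close> to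
    be replaced by its upper bound in the denominator of \<open>a / D\<close>.\<close>
  have "3 * 3 \<le> real n * real n" using n by (intro mult_mono) auto
  hence "1 * 1 \<le> (real n * real n - 2) * l" using l by (intro mult_mono) auto
  hence a0: "a \<ge> 0" using a by simp
  have "ereal (log 2 (real (card S))) > ereal a / ereal_of_enat (Delta G) - 2 \<and>
       ereal a / ereal_of_enat (Delta G) - 2
         \<ge> ereal ((real n + 1) * (l / 12) - (l + 2) / (12 * (real n - 1)) - 2)"
    if S: "nontrivial_conjugacy_class G S" for S
  proof -
    obtain x where x: "x \<in> carrier G" "x \<noteq> \<one>\<^bsub>G\<^esub>" "S = conjugacy_class G x"
      using S by (auto simp: nontrivial_conjugacy_class_def)
    \<comment> \<open>Once \<open>{x}\<close> is eligible, the exact value \<open>D\<close> of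
      \<open>Delta G\<close>, and not merely its upper bound, serves as a radius.\<close>
    have "normally_generates G {x}"
      using x ball[OF x(1,2)] by (intro normally_generates_of_conj_ball) auto
    hence "conj_diameter G {x} \<le> Delta G"
      unfolding Delta_def by (intro SUP_upper) auto
    hence ballD: "g \<in> conj_ball G {x} D" if "g \<in> carrier G" for g
      using that unfolding D conj_diameter_def SUP_le_iff conj_norm_le_iff by blast
    \<comment> \<open>The ball of radius 0 contains only the identity, whereas \<open>x\<close> is
      another element.\<close>
    have "D \<noteq> 0"
    proof
      assume "D = 0"
      hence "x = \<one>\<^bsub>G\<^esub>" using ballD[OF x(1)] by (simp add: conj_ball_def is_conj_product_0)
      thus False using x(2) by blast
    qed
    hence D1: "D \<ge> 1" by simp
    have less: "card (carrier G) < (4 * card S) ^ D"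
      unfolding x(3) by (rule card_carrier_less[OF fin x(1) D1 ballD])
    have pos: "card (carrier G) > 0" using fin card_gt_0_iff by blast
    have S0: "card S > 0"
    proof (rule ccontr)
      assume "\<not> card S > 0"
      hence "(4 * card S) ^ D = 0" using D1 by simp
      thus False using less by linarith
    qed
    have "real (card (carrier G)) < real ((4 * card S) ^ D)"
      using less by (simp only: of_nat_less_iff)
    moreover have "real (card (carrier G)) > 0" using pos by simp
    ultimately have "a < log 2 (real ((4 * card S) ^ D))"
      unfolding a_def by (intro log_less_cancel_iff[THEN iffD2]) (simp, assumption, linarith, assumption)
    also have "\<dots> = real D * log 2 (real (4 * card S))"
      using S0 by (simp only: of_nat_power) (rule log_nat_power, simp)
    also have "log 2 (real (4 * card S)) = 2 + log 2 (real (card S))"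
    proof -
      have "log 2 (4 :: real) = log 2 (2 ^ 2)" by simp
      also have "\<dots> = 2" by (subst log_nat_power) auto
      finally show ?thesis using S0 by (simp add: log_mult)
    qed
    finally have upper: "a / real D - 2 < log 2 (real (card S))"
      using D1 by (simp add: field_simps)
    have n1: "real n - 1 > 0" using n by simp
    have "real D \<le> real (12 * (n - 1))" using D(2) by (simp only: of_nat_le_iff)
    hence "real D \<le> 12 * (real n - 1)" using n by (simp add: of_nat_diff)
    hence "a / (12 * (real n - 1)) \<le> a / real D"
      using a0 D1 n1 by (intro divide_left_mono) auto
    \<comment> \<open>The 1 subtracted in the bound for \<open>a\<close> is weakened to 2 to fit the
      target: over the denominator \<open>12 * (n - 1)\<close>, its numerator is
      \<open>(n * n - 1) * l - (l + 2)\<close>.\<close>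
    moreover have "((real n * real n - 2) * l - 2) / (12 * (real n - 1)) \<le> a / (12 * (real n - 1))"
      using a n1 by (intro divide_right_mono) auto
    moreover have "(real n + 1) * (l / 12) - (l + 2) / (12 * (real n - 1)) =
        ((real n * real n - 2) * l - 2) / (12 * (real n - 1))"
      using n1 by (simp add: field_simps)
    ultimately have lower: "(real n + 1) * (l / 12) - (l + 2) / (12 * (real n - 1)) - 2 \<le> a / real D - 2"
      by linarith
    \<comment> \<open>Because \<open>D \<ge> 1\<close>, the extended real quotient is an ordinary
      real one.\<close>
    have "ereal a / ereal_of_enat (Delta G) - 2 = ereal (a / real D - 2)"
    proof -
      have "(2 :: ereal) = ereal 2" by simp
      thus ?thesis using D1 by (simp only: D ereal_of_enat_simps ereal_divide ereal_minus) simp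
    qed
    thus ?thesis using upper lower by simp
  qed
  thus ?thesis using Delta unfolding a_def l_def by blast
qed

end
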